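(* For every vertex $r$ of a planar triangulation $G$, $G$ has a parent-dominated rooted tree-partition with weak-diameter at most $3\operatorname{tw}(G)+2$ whose root part is $\{r\}$.
   Context: All graphs are finite, simple and undirected; $\operatorname{tw}(G)$ is the treewidth of $G$; $\operatorname{dist}_G$ is the graph distance in $G$. A planar triangulation is a planar graph embedded in the plane such that every face is bounded by a triangle. For a tree $T$, a $T$-partition of $G$ is a collection $(B_x:x\in V(T))$ of pairwise disjoint subsets of $V(G)$ (called parts) whose union is $V(G)$, such that for each edge $vw\in E(G)$, if $v\in B_x$ and $w\in B_y$ then $x=y$ or $xy\in E(T)$. A tree-partition is a $T$-partition for some tree $T$. It is rooted at $r_0\in V(T)$ if $T$ is rooted at $r_0$; the root part is then $B_{r_0}$. A rooted tree-partition $(B_x:x\in V(T))$ is parent-dominated if for each edge $xy\in E(T)$ such that $y$ is the parent of $x$, every vertex in $B_x$ has at least one neighbour (in $G$) in $B_y$. The weak-diameter of $(B_x:x\in V(T))$ is the maximum of $\operatorname{dist}_G(v,w)$ over all vertices $v,w$ belonging to the same part $B_x$. *)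

theory Defs
  imports
    "HOL-Analysis.Analysis"
    "Graph_Theory.Digraph_Component"
    "Graph_Theory.Vertex_Walk"
    "Graph_Theory.Shortest_Path"
begin

text \<open>
  A finite, simple, undirected graph is a \<^locale>\<open>pair_graph\<close>: a finite set of vertices
  with a symmetric, irreflexive relation \<^const>\<open>parcs\<close> on it, so that an edge \<open>{u, v}\<close>
  is represented by the two arcs \<open>(u, v)\<close> and \<open>(v, u)\<close>.
\<close>

text \<open>Keeps the topological \<^const>\<open>Topological_Spaces.connected\<close> accessible by its short name.\<close>

hide_const (open) Digraph_Component.connected Digraph_Component.tree

definition graph_dist :: "'a pair_pre_digraph \<Rightarrow> 'a \<Rightarrow> 'a \<Rightarrow> ereal" where
  "graph_dist G = wf_digraph.\<mu> (with_proj G) (\<lambda>_. 1)"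


section \<open>Trees\<close>

text \<open>
  The library predicate \<^const>\<open>Digraph_Component.tree\<close> is about digraphs: it treats
  \<open>(u, v), (v, u)\<close> as a cycle, so it fails for every symmetric digraph with an arc. Cycles
  in the undirected sense have at least three vertices.
\<close>

definition ucycle :: "'a pair_pre_digraph \<Rightarrow> 'a list \<Rightarrow> bool" where
  "ucycle G p \<longleftrightarrow> vpath p (with_proj G) \<and> 3 \<le> length p \<and> (last p, hd p) \<in> parcs G"

definition utree :: "'a pair_pre_digraph \<Rightarrow> bool" where
  "utree T \<longleftrightarrow> pair_graph T \<and> Digraph_Component.connected (with_proj T) \<and> (\<nexists>p. ucycle T p)"

text \<open>\<open>y\<close> is the parent of \<open>x\<close> in the tree \<open>T\<close> rooted at \<open>r\<^sub>0\<close>: it is the second vertex of the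
  path in \<open>T\<close> from \<open>x\<close> to \<open>r\<^sub>0\<close>.\<close>

definition parent_of :: "'t pair_pre_digraph \<Rightarrow> 't \<Rightarrow> 't \<Rightarrow> 't \<Rightarrow> bool" where
  "parent_of T r\<^sub>0 y x \<longleftrightarrow> (\<exists>p. vpath (x # y # p) (with_proj T) \<and> last (y # p) = r\<^sub>0)"


section \<open>Treewidth\<close>

text \<open>\<^const>\<open>Digraph_Component.connected\<close> includes nonemptiness, so every vertex is in some bag.\<close>

definition tree_decomposition ::
  "'t pair_pre_digraph \<Rightarrow> ('t \<Rightarrow> 'a set) \<Rightarrow> 'a pair_pre_digraph \<Rightarrow> bool" where
  "tree_decomposition T B G \<longleftrightarrow>
     utree T \<and>
     (\<forall>x\<in>pverts T. B x \<subseteq> pverts G) \<and>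
     (\<forall>v\<in>pverts G. Digraph_Component.connected (with_proj T \<restriction> {x\<in>pverts T. v \<in> B x})) \<and>
     (\<forall>(v, w)\<in>parcs G. \<exists>x\<in>pverts T. v \<in> B x \<and> w \<in> B x)"

text \<open>Truncated subtraction only matters for the graph without vertices.\<close>

definition decomposition_width :: "'t pair_pre_digraph \<Rightarrow> ('t \<Rightarrow> 'a set) \<Rightarrow> nat" where
  "decomposition_width T B = Max ((\<lambda>x. card (B x)) ` pverts T) - 1"

text \<open>Trees are finite, so it is no restriction that their nodes are natural numbers.\<close>

definition treewidth :: "'a pair_pre_digraph \<Rightarrow> nat" where
  "treewidth G = (LEAST k. \<exists>(T :: nat pair_pre_digraph) B.
     tree_decomposition T B G \<and> decomposition_width T B = k)"


section \<open>Tree-partitions\<close>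

definition tree_partition ::
  "'t pair_pre_digraph \<Rightarrow> ('t \<Rightarrow> 'a set) \<Rightarrow> 'a pair_pre_digraph \<Rightarrow> bool" where
  "tree_partition T B G \<longleftrightarrow>
     utree T \<and>
     disjoint_family_on B (pverts T) \<and>
     (\<Union>x\<in>pverts T. B x) = pverts G \<and>
     (\<forall>(v, w)\<in>parcs G. \<forall>x\<in>pverts T. \<forall>y\<in>pverts T.
        v \<in> B x \<and> w \<in> B y \<longrightarrow> x = y \<or> (x, y) \<in> parcs T)"

definition rooted_tree_partition ::
  "'t pair_pre_digraph \<Rightarrow> 't \<Rightarrow> ('t \<Rightarrow> 'a set) \<Rightarrow> 'a pair_pre_digraph \<Rightarrow> bool" where
  "rooted_tree_partition T r\<^sub>0 B G \<longleftrightarrow> tree_partition T B G \<and> r\<^sub>0 \<in> pverts T"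

definition parent_dominated ::
  "'t pair_pre_digraph \<Rightarrow> 't \<Rightarrow> ('t \<Rightarrow> 'a set) \<Rightarrow> 'a pair_pre_digraph \<Rightarrow> bool" where
  "parent_dominated T r\<^sub>0 B G \<longleftrightarrow>
     (\<forall>(x, y)\<in>parcs T. parent_of T r\<^sub>0 y x \<longrightarrow> (\<forall>v\<in>B x. \<exists>w\<in>B y. (v, w) \<in> parcs G))"

text \<open>For a tree-partition of a nonempty finite graph the supremum is over a nonempty finite set,
  and thus a maximum. It is infinite if some part meets two components of \<open>G\<close>.\<close>

definition weak_diameter ::
  "'t pair_pre_digraph \<Rightarrow> ('t \<Rightarrow> 'a set) \<Rightarrow> 'a pair_pre_digraph \<Rightarrow> ereal" where
  "weak_diameter T B G =
     Sup {graph_dist G v w | x v w. x \<in> pverts T \<and> v \<in> B x \<and> w \<in> B x}"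


section \<open>Planar triangulations\<close>

text \<open>\<open>p\<close> places the vertices in the plane, and \<open>\<gamma> u v\<close> is the arc from \<open>p u\<close> to \<open>p v\<close> that
  represents the edge \<open>{u, v}\<close>.\<close>

definition plane_embedding ::
  "'a pair_pre_digraph \<Rightarrow> ('a \<Rightarrow> complex) \<Rightarrow> ('a \<Rightarrow> 'a \<Rightarrow> real \<Rightarrow> complex) \<Rightarrow> bool" where
  "plane_embedding G p \<gamma> \<longleftrightarrow>
     inj_on p (pverts G) \<and>
     (\<forall>(u, v)\<in>parcs G.
        arc (\<gamma> u v) \<and> pathstart (\<gamma> u v) = p u \<and> pathfinish (\<gamma> u v) = p v \<and>
        \<gamma> v u = reversepath (\<gamma> u v) \<and>
        path_image (\<gamma> u v) \<inter> p ` pverts G = {p u, p v}) \<and>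
     (\<forall>(u, v)\<in>parcs G. \<forall>(x, y)\<in>parcs G. {u, v} \<noteq> {x, y} \<longrightarrow>
        path_image (\<gamma> u v) \<inter> path_image (\<gamma> x y) = p ` ({u, v} \<inter> {x, y}))"

definition drawing ::
  "'a pair_pre_digraph \<Rightarrow> ('a \<Rightarrow> complex) \<Rightarrow> ('a \<Rightarrow> 'a \<Rightarrow> real \<Rightarrow> complex) \<Rightarrow> complex set" where
  "drawing G p \<gamma> = p ` pverts G \<union> (\<Union>(u, v)\<in>parcs G. path_image (\<gamma> u v))"

definition faces ::
  "'a pair_pre_digraph \<Rightarrow> ('a \<Rightarrow> complex) \<Rightarrow> ('a \<Rightarrow> 'a \<Rightarrow> real \<Rightarrow> complex) \<Rightarrow> complex set set" where
  "faces G p \<gamma> = components (- drawing G p \<gamma>)"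

definition bounded_by_triangle ::
  "'a pair_pre_digraph \<Rightarrow> ('a \<Rightarrow> 'a \<Rightarrow> real \<Rightarrow> complex) \<Rightarrow> complex set \<Rightarrow> bool" where
  "bounded_by_triangle G \<gamma> F \<longleftrightarrow>
     (\<exists>u v w. (u, v) \<in> parcs G \<and> (v, w) \<in> parcs G \<and> (w, u) \<in> parcs G \<and>
        frontier F = path_image (\<gamma> u v) \<union> path_image (\<gamma> v w) \<union> path_image (\<gamma> w u))"

definition planar_triangulation :: "'a pair_pre_digraph \<Rightarrow> bool" where
  "planar_triangulation G \<longleftrightarrow> pair_graph G \<and>
     (\<exists>p \<gamma>. plane_embedding G p \<gamma> \<and> (\<forall>F\<in>faces G p \<gamma>. bounded_by_triangle G \<gamma> F))"

end

theory Submission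
  imports Defs
begin

text \<open>
  Group the vertices at distance \<open>i\<close> from \<open>r\<close> according to the components of the subgraph induced by
  the vertices at distance at least \<open>i\<close>. This is a parent-dominated tree-partition of any connected
  graph. For the weak diameter, planarity enters through one fact: if the vertices of a planar
  triangulation are split into two connected sets \<open>Y\<close> and \<open>Z\<close>, then the vertices of \<open>Z\<close> that have
  a neighbour in \<open>Y\<close> induce a connected subgraph. If a part contained vertices \<open>v\<close> and \<open>w\<close> at
  distance at least \<open>3 * k + 3\<close>, then spheres around \<open>r\<close> and spheres around a piece of a geodesic
  from \<open>v\<close> to \<open>r\<close> would provide \<open>k + 2\<close> disjoint connected rows and \<open>k + 2\<close> disjoint connected
  columns such that every row meets every column, and so the treewidth would exceed \<open>k\<close>.
\<close>

section \<open>Connected vertex sets\<close>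

text \<open>A whole sphere need not induce a connected subgraph. What does is the part of it that
  faces one component of the vertices farther out: that component is connected, and so is its
  complement, because the ball is connected and every other component is attached to it by an edge.
  Hence rows and columns are all taken towards a fixed vertex, and the planarity fact applies to
  each pair of a component and its complement. Rows around \<open>r\<close> and columns around a
  piece of a geodesic are instances of one construction whose centre is any connected set. Different
  rows lie at different distances from the centre, which makes them disjoint. The number
  \<open>k + 2\<close> is one more than the size of the largest bag in a decomposition of width
  \<open>k\<close>: some bag meets all rows or all columns and is too large. The planarity fact is
  proved by topology alone: connected vertex sets become closed connected sets of the plane, and
  unicoherence takes the place of arguments about cycles.\<close>

lemma pair_graph_sym: "pair_graph G \<Longrightarrow> sym (parcs G)"
  unfolding pair_graph_def pair_pseudo_graph_def pair_sym_digraph_def pair_sym_digraph_axioms_def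
  by (simp add: symmetric_def)

lemma pair_graph_parcs_subset: "pair_graph G \<Longrightarrow> parcs G \<subseteq> pverts G \<times> pverts G"
  unfolding pair_graph_def pair_digraph_def pair_fin_digraph_def pair_wf_digraph_def by fastforce

lemma pair_graph_finite: "pair_graph G \<Longrightarrow> finite (pverts G)"
  unfolding pair_graph_def pair_digraph_def pair_fin_digraph_def pair_fin_digraph_axioms_def by simp

lemma pair_graphI:
  assumes "finite (pverts G)" "parcs G \<subseteq> pverts G \<times> pverts G" "sym (parcs G)" "\<And>x. (x, x) \<notin> parcs G"
  shows "pair_graph G"
proof
  show "finite (parcs G)" using assms(1,2) finite_subset by blast
  show "symmetric (with_proj G)" using assms(3) by (simp add: symmetric_def)
qed (use assms in auto)

text \<open>Connectivity of the induced subgraph, since \<open>rtrancl_on\<close> keeps all vertices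
  of a path in \<open>S\<close>. The empty set counts as connected, so nonemptiness is stated
  separately where it matters.\<close>

definition conn :: "'a rel \<Rightarrow> 'a set \<Rightarrow> bool" where
  "conn E S \<longleftrightarrow> (\<forall>x\<in>S. \<forall>y\<in>S. (x, y) \<in> rtrancl_on S E)"

definition component_in :: "'a rel \<Rightarrow> 'a set \<Rightarrow> 'a \<Rightarrow> 'a set" where
  "component_in E S x = {y. (x, y) \<in> rtrancl_on S E}"

lemma conn_cutE:
  assumes "conn E S" "a \<in> S" "a \<in> A" "b \<in> S" "b \<notin> A"
  obtains u v where "u \<in> S" "u \<in> A" "v \<in> S" "v \<notin> A" "(u, v) \<in> E"
proof -
  have "(a, b) \<in> rtrancl_on S E" using assms by (auto simp: conn_def)
  then have "b \<notin> A \<Longrightarrow> \<exists>u v. u \<in> S \<and> u \<in> A \<and> v \<in> S \<and> v \<notin> A \<and> (u, v) \<in> E"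
  proof (induction rule: rtrancl_on_induct)
    case base
    then show ?case using assms by auto
  next
    case (step y z)
    then show ?case by blast
  qed
  then show ?thesis using assms that by blast
qed

lemma component_in_subset: "component_in E S x \<subseteq> S"
  by (auto simp: component_in_def dest: in_rtrancl_on_in_F)

lemma component_in_refl: "x \<in> S \<Longrightarrow> x \<in> component_in E S x"
  by (auto simp: component_in_def)

lemma component_in_step:
  "y \<in> component_in E S x \<Longrightarrow> (y, z) \<in> E \<Longrightarrow> z \<in> S \<Longrightarrow> z \<in> component_in E S x"
  by (auto simp: component_in_def intro: rtrancl_on_into_rtrancl_on)

lemma rtrancl_on_component_in:
  assumes "(x, y) \<in> rtrancl_on S E"
  shows "(x, y) \<in> rtrancl_on (component_in E S x) E"
  using assms
proof (induction rule: rtrancl_on_induct)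
  case base
  then show ?case by (auto simp: component_in_def)
next
  case (step y z)
  moreover have "z \<in> component_in E S x"
    using step by (auto simp: component_in_def intro: rtrancl_on_into_rtrancl_on)
  ultimately show ?case by (meson rtrancl_on_into_rtrancl_on)
qed

lemma conn_fromI:
  assumes "sym E" "\<And>y. y \<in> S \<Longrightarrow> (x, y) \<in> rtrancl_on S E"
  shows "conn E S"
  unfolding conn_def using assms by (meson rtrancl_on_sym rtrancl_on_trans symE)

lemma conn_component_in: "sym E \<Longrightarrow> conn E (component_in E S x)"
  by (rule conn_fromI[where x = x]) (auto simp: component_in_def dest: rtrancl_on_component_in[unfolded component_in_def])

text \<open>The form suited to topology: a split of the vertices that no edge crosses turns into a
  split of a plane set into two closed pieces.\<close>

lemma conn_cutI:
  assumes "sym E"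
    and "\<And>A. A \<subseteq> S \<Longrightarrow> A \<noteq> {} \<Longrightarrow> A \<noteq> S \<Longrightarrow> \<exists>u\<in>A. \<exists>v\<in>S - A. (u, v) \<in> E"
  shows "conn E S"
proof -
  have "component_in E S x = S" if "x \<in> S" for x
  proof (rule ccontr)
    assume "component_in E S x \<noteq> S"
    moreover have "component_in E S x \<noteq> {}" using component_in_refl[OF that] by fast
    ultimately obtain u v where "u \<in> component_in E S x" "v \<in> S - component_in E S x" "(u, v) \<in> E"
      using assms(2)[OF component_in_subset] by blast
    then show False using component_in_step by fast
  qed
  then show ?thesis by (auto simp: conn_def component_in_def)
qed

lemma rtrancl_on_subset: "S \<subseteq> S' \<Longrightarrow> (x, y) \<in> rtrancl_on S E \<Longrightarrow> (x, y) \<in> rtrancl_on S' E"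
  by (rule rtrancl_on_mono) auto

lemma component_in_mono: "S \<subseteq> S' \<Longrightarrow> component_in E S x \<subseteq> component_in E S' x"
  using rtrancl_on_subset[of S S'] by (auto simp: component_in_def)

lemma conn_subset_component_in:
  assumes "conn E K" "K \<subseteq> S" "x \<in> K"
  shows "K \<subseteq> component_in E S x"
  using assms rtrancl_on_subset[OF assms(2)] by (auto simp: component_in_def conn_def)

lemma component_in_eq:
  assumes "sym E" "y \<in> component_in E S x"
  shows "component_in E S y = component_in E S x"
  using assms unfolding component_in_def
  by (auto intro: rtrancl_on_trans) (meson rtrancl_on_sym rtrancl_on_trans symE)

text \<open>Any two points are joined through the core \<open>S\<^sub>0\<close>; balls and
  complements of components are grown from a core in this way.\<close>

lemma conn_attachI:
  assumes "sym E" "conn E S\<^sub>0" "S\<^sub>0 \<subseteq> S"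
    and attach: "\<And>x. x \<in> S \<Longrightarrow> \<exists>K\<subseteq>S. conn E K \<and> x \<in> K \<and> K \<inter> S\<^sub>0 \<noteq> {}"
  shows "conn E S"
proof (cases "S\<^sub>0 = {}")
  case True
  then have "S = {}" using attach by blast
  then show ?thesis by (simp add: conn_def)
next
  case False
  then obtain a where a: "a \<in> S\<^sub>0" by blast
  show ?thesis
  proof (rule conn_fromI[OF assms(1), where x = a])
    fix x assume "x \<in> S"
    then obtain K b where K: "K \<subseteq> S" "conn E K" "x \<in> K" "b \<in> K" "b \<in> S\<^sub>0" using attach by blast
    then have "(a, b) \<in> rtrancl_on S E" "(b, x) \<in> rtrancl_on S E"
      using a assms(2,3) rtrancl_on_subset[of S\<^sub>0 S] rtrancl_on_subset[of K S] by (auto simp: conn_def)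
    then show "(a, x) \<in> rtrancl_on S E" by (rule rtrancl_on_trans)
  qed
qed

lemma conn_singleton: "conn E {x}"
  by (simp add: conn_def)

lemma conn_Un: "sym E \<Longrightarrow> conn E A \<Longrightarrow> conn E B \<Longrightarrow> A \<inter> B \<noteq> {} \<Longrightarrow> conn E (A \<union> B)"
  by (rule conn_attachI[of E A]) blast+

lemma conn_edge: "sym E \<Longrightarrow> (x, y) \<in> E \<Longrightarrow> conn E {x, y}"
  by (rule conn_fromI[where x = x]) (auto intro: rtrancl_on_into_rtrancl_on)

lemma conn_insert:
  assumes "sym E" "conn E A" "x \<in> A" "(x, y) \<in> E"
  shows "conn E (insert y A)"
  using conn_Un[OF assms(1,2) conn_edge[OF assms(1,4)]] assms(3) by (simp add: insert_absorb)

section \<open>Distance layers\<close>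

text \<open>Distance from a set and not only from a vertex, because the columns are layers around a
  whole piece of a geodesic.\<close>

definition lev :: "'a rel \<Rightarrow> 'a set \<Rightarrow> 'a \<Rightarrow> nat" where
  "lev E A v = (LEAST n. \<exists>a\<in>A. (a, v) \<in> E ^^ n)"

locale connected_graph =
  fixes V :: "'a set" and E :: "'a rel"
  assumes fin: "finite V" and sym: "sym E" and edges: "E \<subseteq> V \<times> V" and conn: "conn E V"
begin

lemma relpow_exists: "a \<in> V \<Longrightarrow> v \<in> V \<Longrightarrow> \<exists>n. (a, v) \<in> E ^^ n"
  using conn rtrancl_on_rtranclI unfolding conn_def by (metis rtrancl_power)

lemma relpow_sym: "(a, b) \<in> E ^^ n \<Longrightarrow> (b, a) \<in> E ^^ n"
proof (induction n arbitrary: b)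
  case (Suc n)
  then obtain c where "(c, a) \<in> E ^^ n" "(b, c) \<in> E" using sym by (auto dest: symD)
  then show ?case by (metis relpow_Suc_I2)
qed auto

context
  fixes A assumes A: "A \<noteq> {}" "A \<subseteq> V"
begin

lemma lev_witness: assumes "v \<in> V" obtains a where "a \<in> A" "(a, v) \<in> E ^^ lev E A v"
proof -
  have "\<exists>n. \<exists>a\<in>A. (a, v) \<in> E ^^ n" using A assms relpow_exists by blast
  then have "\<exists>a\<in>A. (a, v) \<in> E ^^ lev E A v" unfolding lev_def by (rule LeastI_ex)
  then show ?thesis using that by blast
qed

lemma lev_le: "a \<in> A \<Longrightarrow> (a, v) \<in> E ^^ n \<Longrightarrow> lev E A v \<le> n"
  unfolding lev_def by (rule Least_le) blast

lemma lev_eq_0_iff: "v \<in> V \<Longrightarrow> lev E A v = 0 \<longleftrightarrow> v \<in> A"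
proof
  assume "v \<in> V" "lev E A v = 0"
  then show "v \<in> A" using lev_witness[of v] by (metis pair_in_Id_conv relpow.simps(1))
next
  assume "v \<in> A"
  then show "lev E A v = 0" using lev_le[of v v 0] by simp
qed

lemma lev_edge: assumes "(u, v) \<in> E" shows "lev E A v \<le> Suc (lev E A u)"
proof -
  have "u \<in> V" using assms edges by auto
  then obtain a where "a \<in> A" "(a, u) \<in> E ^^ lev E A u" by (rule lev_witness)
  then show ?thesis using assms by (intro lev_le[of a]) auto
qed

lemma lev_predecessor:
  assumes "v \<in> V" "lev E A v = Suc n"
  obtains u where "(u, v) \<in> E" "u \<in> V" "lev E A u = n"
proof -
  obtain a where a: "a \<in> A" "(a, v) \<in> E ^^ Suc n" using assms lev_witness by metis
  then obtain u where u: "(a, u) \<in> E ^^ n" "(u, v) \<in> E" by auto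
  moreover have "lev E A u = n" using lev_le[OF a(1) u(1)] lev_edge[OF u(2)] assms by linarith
  ultimately show ?thesis using that edges by blast
qed

lemma conn_ball: assumes "conn E A" shows "conn E {v \<in> V. lev E A v \<le> s}"
proof (induction s)
  case 0
  have "{v \<in> V. lev E A v \<le> 0} = A" using A lev_eq_0_iff by auto
  then show ?case using assms by simp
next
  case (Suc s)
  show ?case
  proof (rule conn_attachI[OF sym Suc])
    fix x assume x: "x \<in> {v \<in> V. lev E A v \<le> Suc s}"
    show "\<exists>K\<subseteq>{v \<in> V. lev E A v \<le> Suc s}. conn E K \<and> x \<in> K \<and> K \<inter> {v \<in> V. lev E A v \<le> s} \<noteq> {}"
    proof (cases "lev E A x \<le> s")
      case True
      then show ?thesis using x conn_singleton by (intro exI[of _ "{x}"]) auto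
    next
      case False
      then obtain u where "(u, x) \<in> E" "u \<in> V" "lev E A u = s" using x lev_predecessor[of x s] by auto
      then show ?thesis using x conn_edge[OF sym] by (intro exI[of _ "{u, x}"]) auto
    qed
  qed auto
qed

end

section \<open>Components left after removing a connected set\<close>

lemma component_in_leave:
  assumes "X \<subseteq> V" "X \<noteq> {}" "b \<in> V - X"
  obtains u x where "u \<in> component_in E (V - X) b" "x \<in> X" "(u, x) \<in> E"
proof -
  obtain a where a: "a \<in> X" using assms by blast
  have aV: "a \<in> V" and aC: "a \<notin> component_in E (V - X) b"
    using a assms component_in_subset[of E "V - X" b] by auto
  have "b \<in> V" "b \<in> component_in E (V - X) b" using assms component_in_refl[of b "V - X" E] by auto
  then obtain u x where ux: "u \<in> component_in E (V - X) b" "x \<notin> component_in E (V - X) b" "(u, x) \<in> E"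
    by (rule conn_cutE[OF conn _ _ aV aC])
  then have "x \<notin> V - X" using component_in_step[OF ux(1,3)] by blast
  then have "x \<in> X" using ux edges by auto
  then show ?thesis using that ux by blast
qed

text \<open>Each component of \<open>V - X\<close> other than that of \<open>b\<close> has an edge
  into \<open>X\<close>, so it can be added to \<open>X\<close> without losing connectivity. This
  supplies the second connected side that \<open>bond\<close> asks for.\<close>

lemma conn_compl_component_in:
  assumes "X \<subseteq> V" "X \<noteq> {}" "conn E X"
  shows "conn E (V - component_in E (V - X) b)"
proof (rule conn_attachI[OF sym assms(3)])
  show "X \<subseteq> V - component_in E (V - X) b" using assms component_in_subset[of E "V - X" b] by auto
next
  fix x assume x: "x \<in> V - component_in E (V - X) b"
  show "\<exists>K\<subseteq>V - component_in E (V - X) b. conn E K \<and> x \<in> K \<and> K \<inter> X \<noteq> {}"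
  proof (cases "x \<in> X")
    case True
    then show ?thesis using x conn_singleton by (intro exI[of _ "{x}"]) auto
  next
    case False
    then obtain u y where uy: "u \<in> component_in E (V - X) x" "y \<in> X" "(u, y) \<in> E"
      using component_in_leave[OF assms(1,2)] x by blast
    let ?K = "insert y (component_in E (V - X) x)"
    have "conn E ?K" by (rule conn_insert[OF sym conn_component_in[OF sym] uy(1,3)])
    moreover have "component_in E (V - X) x \<inter> component_in E (V - X) b = {}"
    proof (rule ccontr)
      assume "\<not> ?thesis"
      then obtain z where "z \<in> component_in E (V - X) x" "z \<in> component_in E (V - X) b" by blast
      then have "component_in E (V - X) x = component_in E (V - X) b"
        using component_in_eq[OF sym] by metis
      then show False using component_in_refl[of x "V - X" E] x False by blast
    qed
    moreover have "y \<notin> component_in E (V - X) b"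
      using uy component_in_subset[of E "V - X" b] by blast
    ultimately show ?thesis using uy x False component_in_refl[of x "V - X" E]
        component_in_subset[of E "V - X" x] assms(1)
      by (intro exI[of _ ?K]) auto
  qed
qed

end

text \<open>The only consequence of being a planar triangulation that the argument uses.\<close>

locale bond_graph = connected_graph +
  assumes bond: "\<lbrakk>Y \<noteq> {}; Z \<noteq> {}; Y \<inter> Z = {}; Y \<union> Z = V; conn E Y; conn E Z\<rbrakk> \<Longrightarrow> conn E (Z \<inter> E `` Y)"
begin

definition beyond :: "'a set \<Rightarrow> 'a \<Rightarrow> nat \<Rightarrow> 'a set" where
  "beyond A b s = component_in E {v \<in> V. s \<le> lev E A v} b"

text \<open>For \<open>s < n\<close> this is the part of the sphere of radius \<open>s\<close> around \<open>A\<close> that bounds the component of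
  \<open>b\<close>. The exceptional case \<open>s = n\<close> provides one more set disjoint from the others.\<close>

definition layer :: "'a set \<Rightarrow> 'a \<Rightarrow> nat \<Rightarrow> nat \<Rightarrow> 'a set" where
  "layer A b n s = (if s < n then (V - beyond A b (Suc s)) \<inter> E `` beyond A b (Suc s) else beyond A b n)"

context
  fixes A b n
  assumes A: "A \<noteq> {}" "A \<subseteq> V" "conn E A" and b: "b \<in> V" "n \<le> lev E A b"
begin

text \<open>For \<open>s < n\<close> the two sides for \<open>bond\<close> are
  \<open>beyond A b (Suc s)\<close> and its complement, which is connected because the ball of
  radius \<open>s\<close> is.\<close>

lemma conn_layer: assumes "s \<le> n" shows "conn E (layer A b n s)"
proof (cases "s < n")
  case True
  let ?X = "{v \<in> V. lev E A v \<le> s}"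
  have eq: "{v \<in> V. Suc s \<le> lev E A v} = V - ?X" by auto
  have X: "?X \<noteq> {}" "conn E ?X" using A lev_eq_0_iff[OF A(1,2)] conn_ball[OF A(1,2)] by fastforce+
  have "b \<in> beyond A b (Suc s)"
    unfolding beyond_def using b True by (intro component_in_refl) auto
  moreover have "conn E (V - beyond A b (Suc s))"
    unfolding beyond_def eq using X by (intro conn_compl_component_in) auto
  moreover have "beyond A b (Suc s) \<subseteq> V - ?X" unfolding beyond_def eq by (rule component_in_subset)
  ultimately show ?thesis
    using X(1) True unfolding layer_def
    by (simp, intro bond) (auto simp: beyond_def intro: conn_component_in sym)
qed (simp add: layer_def beyond_def conn_component_in sym)

text \<open>A vertex of the layer has a neighbour in the component beyond radius \<open>s\<close>.
  If its own distance exceeded \<open>s\<close>, it would belong to that component; as distances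
  change by at most one along an edge, only \<open>s\<close> remains.\<close>

lemma lev_layer_less:
  assumes "s < n" "x \<in> layer A b n s" shows "lev E A x = s"
proof -
  obtain u where x: "x \<in> V" "x \<notin> beyond A b (Suc s)" and u: "u \<in> beyond A b (Suc s)" "(u, x) \<in> E"
    using assms by (auto simp: layer_def)
  have "\<not> Suc s \<le> lev E A x"
    using x u component_in_step[of u E _ b x] unfolding beyond_def by blast
  moreover have "Suc s \<le> lev E A u"
    using u component_in_subset[of E "{v \<in> V. Suc s \<le> lev E A v}" b] unfolding beyond_def by blast
  moreover have "lev E A u \<le> Suc (lev E A x)" using lev_edge[OF A(1,2)] u sym by (meson symD)
  ultimately show ?thesis by linarith
qed

lemma lev_layer_top: "x \<in> layer A b n n \<Longrightarrow> n \<le> lev E A x"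
  using component_in_subset[of E "{v \<in> V. n \<le> lev E A v}" b] by (auto simp: layer_def beyond_def)

text \<open>Truncation at \<open>n\<close> covers the top set as well, whose vertices may have any
  distance from \<open>n\<close> on.\<close>

lemma lev_layer: "s \<le> n \<Longrightarrow> x \<in> layer A b n s \<Longrightarrow> min n (lev E A x) = s"
  using lev_layer_less lev_layer_top by (cases "s < n") auto

lemma layer_disjoint: assumes "s \<le> n" "t \<le> n" "s \<noteq> t" shows "layer A b n s \<inter> layer A b n t = {}"
  using lev_layer[OF assms(1)] lev_layer[OF assms(2)] assms(3) by blast

lemma layer_subset: "layer A b n s \<subseteq> V"
proof -
  have "beyond A b n \<subseteq> V"
    using component_in_subset[of E "{v \<in> V. n \<le> lev E A v}" b] unfolding beyond_def by blast
  then show ?thesis by (auto simp: layer_def)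
qed

text \<open>\<open>S\<close> reaches from within radius \<open>s\<close> into the component of
  \<open>b\<close>. The edge by which it enters \<open>beyond A b (Suc s)\<close> has its outer end
  in the layer.\<close>

lemma layer_meets:
  assumes "conn E S" "S \<subseteq> V" "x \<in> S" "y \<in> S" "lev E A x \<le> s" "y \<in> beyond A b n" "s \<le> n"
  shows "S \<inter> layer A b n s \<noteq> {}"
proof (cases "s < n")
  case True
  have "beyond A b n \<subseteq> beyond A b (Suc s)"
    unfolding beyond_def using True by (intro component_in_mono) auto
  then have y: "y \<in> beyond A b (Suc s)" using assms by auto
  have "x \<notin> beyond A b (Suc s)"
    using assms component_in_subset[of E "{v \<in> V. Suc s \<le> lev E A v}" b] by (auto simp: beyond_def)
  then obtain u v where "u \<in> S" "u \<in> beyond A b (Suc s)" "v \<in> S" "v \<notin> beyond A b (Suc s)" "(u, v) \<in> E"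
    using conn_cutE[OF assms(1,4) y assms(3)] by metis
  then show ?thesis using True edges by (auto simp: layer_def)
qed (use assms in \<open>auto simp: layer_def\<close>)

end

text \<open>Following predecessors \<open>a\<close> times from \<open>v\<close> traces the end of a
  geodesic from \<open>r\<close>. The walks of length at most \<open>a\<close> are recorded because
  they later bound the distance between two such pieces.\<close>

lemma descending_segment:
  assumes "v \<in> V" "r \<in> V" "a \<le> lev E {r} v"
  obtains A x where "A \<subseteq> V" "conn E A" "v \<in> A" "x \<in> A" "lev E {r} x = lev E {r} v - a"
    "\<And>y. y \<in> A \<Longrightarrow> \<exists>m\<le>a. (v, y) \<in> E ^^ m"
proof -
  have "\<exists>A x. A \<subseteq> V \<and> conn E A \<and> v \<in> A \<and> x \<in> A \<and> lev E {r} x = lev E {r} v - a \<and> (v, x) \<in> E ^^ a \<and>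
    (\<forall>y\<in>A. \<exists>m\<le>a. (v, y) \<in> E ^^ m)" using assms(3)
  proof (induction a)
    case 0
    then show ?case using assms conn_singleton by (intro exI[of _ "{v}"] exI[of _ v]) auto
  next
    case (Suc a)
    then obtain A x where A: "A \<subseteq> V" "conn E A" "v \<in> A" "x \<in> A" "lev E {r} x = lev E {r} v - a"
      "(v, x) \<in> E ^^ a" "\<forall>y\<in>A. \<exists>m\<le>a. (v, y) \<in> E ^^ m" by auto
    have "lev E {r} x = Suc (lev E {r} v - Suc a)" using A Suc by auto
    then obtain u where u: "(u, x) \<in> E" "u \<in> V" "lev E {r} u = lev E {r} v - Suc a"
      using lev_predecessor[of "{r}" x] A assms by auto
    have xu: "(x, u) \<in> E" using u sym by (auto dest: symD)
    have "(v, u) \<in> E ^^ Suc a" using A xu by auto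
    moreover have "conn E (insert u A)" using conn_insert[OF sym A(2,4) xu] .
    moreover have "\<exists>m\<le>Suc a. (v, y) \<in> E ^^ m" if "y \<in> insert u A" for y
    proof (cases "y = u")
      case True
      then show ?thesis using \<open>(v, u) \<in> E ^^ Suc a\<close> by blast
    next
      case False
      then show ?thesis using that A(7) le_SucI by blast
    qed
    ultimately show ?case using A u by (intro exI[of _ "insert u A"] exI[of _ u]) (simp del: relpow.simps)
  qed
  then show ?thesis using that by metis
qed

text \<open>With \<open>A\<close> and \<open>B\<close> the last \<open>k + 1\<close> edges of geodesics from \<open>r\<close> to \<open>v\<close> and \<open>w\<close>, the rows
  are layers around \<open>r\<close> and the columns are layers around \<open>A\<close>, all taken towards \<open>w\<close>. Each row
  joins \<open>A\<close> to \<open>B\<close>, while each column separates \<open>A\<close> from \<open>B\<close> or contains \<open>B\<close>. The constant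
  \<open>3 * k + 2\<close> arises as \<open>(k + 1) + k + (k + 1)\<close>.\<close>

lemma grid_of_far_vertices:
  assumes "r \<in> V" "v \<in> V" "w \<in> component_in E {x \<in> V. lev E {r} v \<le> lev E {r} x} v"
    and eq: "lev E {r} w = lev E {r} v"
    and far: "\<And>m. m \<le> 3 * k + 2 \<Longrightarrow> (v, w) \<notin> E ^^ m"
  obtains R C :: "nat \<Rightarrow> 'a set" where
    "\<And>j. j \<le> Suc k \<Longrightarrow> conn E (R j) \<and> R j \<subseteq> V" "\<And>j. j \<le> Suc k \<Longrightarrow> conn E (C j) \<and> C j \<subseteq> V"
    "disjoint_family_on R {..Suc k}" "disjoint_family_on C {..Suc k}"
    "\<And>i j. i \<le> Suc k \<Longrightarrow> j \<le> Suc k \<Longrightarrow> R i \<inter> C j \<noteq> {}"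
proof -
  define i where "i = lev E {r} v"
  have w: "w \<in> V"
    using assms(3) component_in_subset[of E "{x \<in> V. lev E {r} v \<le> lev E {r} x}" v] by blast
  have r: "{r} \<noteq> {}" "{r} \<subseteq> V" using assms by auto
  \<comment> \<open>There is room for the pieces of length \<open>Suc k\<close>: if
    \<open>i \<le> k\<close>, the walk from \<open>v\<close> to \<open>w\<close> through
    \<open>r\<close> would have length \<open>i + i\<close>, at most \<open>2 * k\<close>.\<close>
  have "Suc k \<le> i"
  proof (rule ccontr)
    assume "\<not> Suc k \<le> i"
    obtain "(r, v) \<in> E ^^ i" "(r, w) \<in> E ^^ i"
      using lev_witness[OF r assms(2)] lev_witness[OF r w] eq by (metis i_def singletonD)
    then have "(v, w) \<in> E ^^ (i + i)" using relpow_sym by (auto simp: relpow_add)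
    then show False using far[of "i + i"] \<open>\<not> Suc k \<le> i\<close> by linarith
  qed
  obtain A x where A: "A \<subseteq> V" "conn E A" "v \<in> A" "x \<in> A" "lev E {r} x = i - Suc k"
    "\<And>y. y \<in> A \<Longrightarrow> \<exists>m\<le>Suc k. (v, y) \<in> E ^^ m"
    using descending_segment[OF assms(2,1), of "Suc k"] \<open>Suc k \<le> i\<close> i_def by metis
  obtain B y where B: "B \<subseteq> V" "conn E B" "w \<in> B" "y \<in> B" "lev E {r} y = i - Suc k"
    "\<And>y. y \<in> B \<Longrightarrow> \<exists>m\<le>Suc k. (w, y) \<in> E ^^ m"
    using descending_segment[OF w assms(1), of "Suc k"] \<open>Suc k \<le> i\<close> i_def eq by metis
  have A0: "A \<noteq> {}" using A by auto
  have dist: "Suc k \<le> lev E A z" if z: "z \<in> B" for z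
  proof (rule ccontr)
    assume *: "\<not> Suc k \<le> lev E A z"
    obtain a where a: "a \<in> A" "(a, z) \<in> E ^^ lev E A z" using lev_witness[OF A0 A(1)] z B by blast
    obtain m where m: "m \<le> Suc k" "(v, a) \<in> E ^^ m" using A a by blast
    obtain m' where m': "m' \<le> Suc k" "(w, z) \<in> E ^^ m'" using B z by blast
    have "(v, w) \<in> E ^^ (m + lev E A z + m')"
      using m a relpow_sym[OF m'(2)] by (auto simp: relpow_add)
    then show False using far[of "m + lev E A z + m'"] m m' * by linarith
  qed
  \<comment> \<open>The radii of the rows run from \<open>i - Suc k\<close> to \<open>i\<close>. The
    last row is the exceptional case of \<open>layer\<close>, a whole component, and so is the last
    column.\<close>
  define R where "R j = layer {r} w i (i - Suc k + j)" for j
  define C where "C j = layer A w (Suc k) j" for j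
  note rows = r conn_singleton[of E r] w
  note cols = A0 A(1,2) w dist[OF B(3)]
  have i: "i \<le> lev E {r} w" using eq i_def by simp
  have vw: "v \<in> beyond {r} w i" "w \<in> beyond {r} w i"
    using assms(3) component_in_eq[OF sym assms(3)] component_in_refl[of v _ E] component_in_refl[of w _ E]
      component_in_subset[of E _ v] assms(2)
    by (auto simp: beyond_def i_def[symmetric])
  have Bsub: "B \<subseteq> beyond A w (Suc k)"
    unfolding beyond_def using B dist by (intro conn_subset_component_in) auto
  \<comment> \<open>\<open>A\<close> climbs from the smallest radius \<open>i - Suc k\<close> to
    \<open>v\<close>, which lies in the top row, so it crosses every row; the same holds for
    \<open>B\<close> and \<open>w\<close>.\<close>
  have RA: "A \<inter> R j \<noteq> {}" if "j \<le> Suc k" for j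
    unfolding R_def using that \<open>Suc k \<le> i\<close> A(5) vw(1) by (intro layer_meets[OF rows i A(2,1,4,3)]) auto
  have RB: "B \<inter> R j \<noteq> {}" if "j \<le> Suc k" for j
    unfolding R_def using that \<open>Suc k \<le> i\<close> B(5) vw(2) by (intro layer_meets[OF rows i B(2,1,4,3)]) auto
  have meet: "R j \<inter> C l \<noteq> {}" if jl: "j \<le> Suc k" "l \<le> Suc k" for j l
  proof -
    have "conn E (R j)" "R j \<subseteq> V"
      unfolding R_def using jl \<open>Suc k \<le> i\<close> conn_layer[OF rows i] layer_subset[OF rows i] by auto
    moreover obtain a where a: "a \<in> R j" "a \<in> A" using RA[OF jl(1)] by blast
    moreover obtain b where b: "b \<in> R j" "b \<in> B" using RB[OF jl(1)] by blast
    moreover have "lev E A a \<le> l" using lev_eq_0_iff[OF A0 A(1), of a] a A(1) by auto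
    ultimately show ?thesis unfolding C_def using Bsub jl(2)
      by (intro layer_meets[OF cols _ _ a(1) b(1)]) auto
  qed
  have dR: "disjoint_family_on R {..Suc k}"
    unfolding disjoint_family_on_def R_def using \<open>Suc k \<le> i\<close>
    by (intro ballI impI layer_disjoint[OF rows i]) auto
  have dC: "disjoint_family_on C {..Suc k}"
    unfolding disjoint_family_on_def C_def
    by (intro ballI impI layer_disjoint[OF cols]) auto
  have cR: "conn E (R j) \<and> R j \<subseteq> V" if "j \<le> Suc k" for j
    unfolding R_def using that \<open>Suc k \<le> i\<close>
    by (intro conjI conn_layer[OF rows i] layer_subset[OF rows i]) auto
  have cC: "conn E (C j) \<and> C j \<subseteq> V" if "j \<le> Suc k" for j
    unfolding C_def by (rule conjI[OF conn_layer[OF cols that] layer_subset[OF cols]])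
  show ?thesis by (rule that[of R C, OF cR cC dR dC meet])
qed

end

section \<open>Bonds of planar triangulations\<close>

text \<open>A small ball around a limit point outside \<open>K\<close> misses \<open>K\<close>. If
  it meets some \<open>F\<close> without being contained in it, it meets the frontier of
  \<open>F\<close>, which lies in \<open>K\<close>. The argument covers infinite families, so the
  faces never have to be counted.\<close>

lemma closed_Un_Union_frontier:
  fixes K :: "'b::real_normed_vector set"
  assumes "closed K" "\<And>F. F \<in> \<F> \<Longrightarrow> frontier F \<subseteq> K"
  shows "closed (K \<union> \<Union>\<F>)"
proof -
  have "x \<in> K \<union> \<Union>\<F>" if x: "x \<in> closure (\<Union>\<F>)" for x
  proof (rule ccontr)
    assume *: "x \<notin> K \<union> \<Union>\<F>"
    then have "x \<in> - K" "open (- K)" using assms(1) by auto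
    then obtain e where "e > 0" "ball x e \<subseteq> - K" by (metis openE)
    then have e: "e > 0" "ball x e \<inter> K = {}" by auto
    obtain y F where y: "y \<in> F" "F \<in> \<F>" "y \<in> ball x e"
      using x e(1) by (auto simp: closure_approachable dist_commute)
    have "connected (ball x e)" by simp
    moreover have "ball x e \<inter> F \<noteq> {}" using y by blast
    moreover have "x \<in> ball x e - F" using y * e(1) by auto
    then have "ball x e - F \<noteq> {}" by blast
    ultimately have "ball x e \<inter> frontier F \<noteq> {}" by (rule connected_Int_frontier)
    then show False using assms(2)[OF y(2)] e(2) by blast
  qed
  then have "closure (K \<union> \<Union>\<F>) \<subseteq> K \<union> \<Union>\<F>" using assms(1) by (auto simp: closure_Un)
  then show ?thesis by (simp only: closure_subset_eq)
qed

lemma connected_attachI: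
  assumes "connected S\<^sub>0" "S\<^sub>0 \<subseteq> S"
    and "\<And>x. x \<in> S \<Longrightarrow> \<exists>K\<subseteq>S. connected K \<and> x \<in> K \<and> K \<inter> S\<^sub>0 \<noteq> {}"
  shows "connected S"
proof (cases "S\<^sub>0 = {}")
  case True
  then have "S = {}" using assms(3) by blast
  then show ?thesis by simp
next
  case False
  then obtain a where a: "a \<in> S\<^sub>0" by blast
  have "connected_component S a x" if x: "x \<in> S" for x
  proof -
    obtain K b where "K \<subseteq> S" "connected K" "x \<in> K" "b \<in> K" "b \<in> S\<^sub>0" using assms(3)[OF x] by blast
    then have "connected_component S a b" "connected_component S b x"
      using a assms(1,2) unfolding connected_component_def by blast+
    then show ?thesis by (rule connected_component_trans)
  qed
  then show ?thesis unfolding connected_iff_connected_component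
    by (meson connected_component_sym connected_component_trans)
qed

locale triangulation =
  fixes G :: "'a pair_pre_digraph" and p :: "'a \<Rightarrow> complex" and \<gamma> :: "'a \<Rightarrow> 'a \<Rightarrow> real \<Rightarrow> complex"
  assumes graph: "pair_graph G"
    and embedding: "plane_embedding G p \<gamma>"
    and triangular: "\<And>F. F \<in> faces G p \<gamma> \<Longrightarrow> bounded_by_triangle G \<gamma> F"
begin

section \<open>Vertices, edges and induced subgraphs in the plane\<close>

lemmas finite_pverts = pair_graph_finite[OF graph]
  and parcs_subset = pair_graph_parcs_subset[OF graph]
  and sym_parcs = pair_graph_sym[OF graph]

lemma finite_parcs: "finite (parcs G)"
  using finite_subset[OF parcs_subset] finite_pverts by simp

lemma p_eq_iff: "u \<in> pverts G \<Longrightarrow> v \<in> pverts G \<Longrightarrow> p u = p v \<longleftrightarrow> u = v"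
  using embedding by (auto simp: plane_embedding_def inj_on_def)

lemma edge_arc:
  assumes "(u, v) \<in> parcs G"
  shows "arc (\<gamma> u v)" "p u \<in> path_image (\<gamma> u v)" "p v \<in> path_image (\<gamma> u v)"
    "path_image (\<gamma> v u) = path_image (\<gamma> u v)" "path_image (\<gamma> u v) \<inter> p ` pverts G = {p u, p v}"
proof -
  have *: "arc (\<gamma> u v) \<and> pathstart (\<gamma> u v) = p u \<and> pathfinish (\<gamma> u v) = p v \<and>
        \<gamma> v u = reversepath (\<gamma> u v) \<and> path_image (\<gamma> u v) \<inter> p ` pverts G = {p u, p v}"
    using embedding assms unfolding plane_embedding_def by blast
  then show "arc (\<gamma> u v)" "path_image (\<gamma> v u) = path_image (\<gamma> u v)"
    "path_image (\<gamma> u v) \<inter> p ` pverts G = {p u, p v}" by simp_all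
  then show "p u \<in> path_image (\<gamma> u v)" "p v \<in> path_image (\<gamma> u v)" by blast+
qed

lemma edge_closed_connected:
  assumes "(u, v) \<in> parcs G"
  shows "closed (path_image (\<gamma> u v))" "connected (path_image (\<gamma> u v))"
  using edge_arc(1)[OF assms] by (auto simp: closed_path_image connected_path_image arc_imp_path)

lemma vertex_on_edge: "(u, v) \<in> parcs G \<Longrightarrow> y \<in> pverts G \<Longrightarrow> p y \<in> path_image (\<gamma> u v) \<Longrightarrow> y = u \<or> y = v"
  using edge_arc(5)[of u v] p_eq_iff parcs_subset by blast

lemma edges_meet:
  assumes "(u, v) \<in> parcs G" "(x, y) \<in> parcs G" "{u, v} \<noteq> {x, y}"
  shows "path_image (\<gamma> u v) \<inter> path_image (\<gamma> x y) = p ` ({u, v} \<inter> {x, y})"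
  using embedding assms unfolding plane_embedding_def by blast

text \<open>The drawing of the subgraph induced by \<open>W\<close>: an edge with just one end in
  \<open>W\<close> contributes only that end.\<close>

definition subdrawing :: "'a set \<Rightarrow> complex set" where
  "subdrawing W = p ` W \<union> (\<Union>(u, v)\<in>parcs G \<inter> W \<times> W. path_image (\<gamma> u v))"

lemma subdrawing_vertex: "v \<in> W \<Longrightarrow> p v \<in> subdrawing W"
  and subdrawing_edge: "(u, v) \<in> parcs G \<Longrightarrow> u \<in> W \<Longrightarrow> v \<in> W \<Longrightarrow> path_image (\<gamma> u v) \<subseteq> subdrawing W"
  by (auto simp: subdrawing_def)

lemma subdrawingE:
  assumes "x \<in> subdrawing W"
  obtains v where "v \<in> W" "x = p v" | u v where "(u, v) \<in> parcs G" "u \<in> W" "v \<in> W" "x \<in> path_image (\<gamma> u v)"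
  using assms by (auto simp: subdrawing_def)

lemma drawing_eq: "drawing G p \<gamma> = subdrawing (pverts G)"
  using parcs_subset by (fastforce simp: drawing_def subdrawing_def)

lemma subdrawing_mono: "W \<subseteq> W' \<Longrightarrow> subdrawing W \<subseteq> subdrawing W'"
  unfolding subdrawing_def by blast

lemma closed_subdrawing: assumes "W \<subseteq> pverts G" shows "closed (subdrawing W)"
  unfolding subdrawing_def
proof (intro closed_Un)
  show "closed (p ` W)" using finite_subset[OF assms finite_pverts] by (simp add: finite_imp_closed)
  show "closed (\<Union>(u, v)\<in>parcs G \<inter> W \<times> W. path_image (\<gamma> u v))"
    using finite_parcs edge_closed_connected(1) by (intro closed_UN) auto
qed

lemma subdrawing_disjoint:
  assumes "A \<subseteq> pverts G" "B \<subseteq> pverts G" "A \<inter> B = {}"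
  shows "subdrawing A \<inter> subdrawing B = {}"
proof -
  have False if x: "x \<in> subdrawing A" "x \<in> subdrawing B" for x
    using x(1)
  proof (cases rule: subdrawingE)
    case a: (1 a)
    from x(2) show ?thesis
    proof (cases rule: subdrawingE)
      case (1 b)
      then show ?thesis using a assms p_eq_iff by blast
    next
      case (2 u v)
      then show ?thesis using vertex_on_edge[of u v a] a assms by blast
    qed
  next
    case a: (2 a a')
    from x(2) show ?thesis
    proof (cases rule: subdrawingE)
      case (1 b)
      then show ?thesis using vertex_on_edge[of a a' b] a assms by blast
    next
      case (2 u v)
      then have "{a, a'} \<inter> {u, v} = {}" using a assms by blast
      then show ?thesis using edges_meet[of a a' u v] a 2 by blast
    qed
  qed
  then show ?thesis by blast
qed

lemma connected_subdrawing: assumes "conn (parcs G) W" shows "connected (subdrawing W)"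
proof -
  have vertices: "connected_component (subdrawing W) (p x) (p y)" if "(x, y) \<in> rtrancl_on W (parcs G)" for x y
    using that
  proof (induction rule: rtrancl_on_induct)
    case base
    then show ?case by (simp add: subdrawing_vertex)
  next
    case (step y z)
    then have "connected_component (subdrawing W) (p y) (p z)"
      unfolding connected_component_def
      using subdrawing_edge[of y z W] edge_arc(2,3)[of y z] edge_closed_connected(2)[of y z] by blast
    then show ?case using step connected_component_trans by metis
  qed
  have vertex: "\<exists>w\<in>W. connected_component (subdrawing W) x (p w)" if x: "x \<in> subdrawing W" for x
    using x
  proof (cases rule: subdrawingE)
    case (1 v)
    then show ?thesis using x by (auto intro: bexI[of _ v])
  next
    case (2 u v)
    then have "connected_component (subdrawing W) x (p u)"
      unfolding connected_component_def
      using subdrawing_edge[of u v W] edge_arc(2)[of u v] edge_closed_connected(2)[of u v] by blast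
    then show ?thesis using 2 by blast
  qed
  show ?thesis unfolding connected_iff_connected_component
  proof (intro ballI)
    fix x y assume "x \<in> subdrawing W" "y \<in> subdrawing W"
    then obtain u v where uv: "u \<in> W" "connected_component (subdrawing W) x (p u)"
      "v \<in> W" "connected_component (subdrawing W) y (p v)" using vertex by metis
    then have "connected_component (subdrawing W) (p u) (p v)" using vertices assms by (auto simp: conn_def)
    then show "connected_component (subdrawing W) x y"
      using uv by (meson connected_component_sym connected_component_trans)
  qed
qed

section \<open>Faces and their corners\<close>

lemma face_props:
  assumes "F \<in> faces G p \<gamma>"
  shows "connected F" "F \<inter> subdrawing (pverts G) = {}"
  using assms in_components_connected in_components_subset unfolding faces_def drawing_eq by fast+

lemma faces_cover: "x \<in> subdrawing (pverts G) \<or> (\<exists>F\<in>faces G p \<gamma>. x \<in> F)"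
  unfolding faces_def drawing_eq using Union_components[of "- subdrawing (pverts G)"] by blast

lemma faces_disjoint: "F \<in> faces G p \<gamma> \<Longrightarrow> F' \<in> faces G p \<gamma> \<Longrightarrow> x \<in> F \<Longrightarrow> x \<in> F' \<Longrightarrow> F = F'"
  unfolding faces_def using components_nonoverlap by fast

text \<open>Read off from the frontier, so that no bounding triangle has to be chosen;
  \<open>face_triangleE\<close> recovers the three vertices of one.\<close>

definition corners :: "complex set \<Rightarrow> 'a set" where
  "corners F = {v \<in> pverts G. p v \<in> frontier F}"

lemma face_triangleE:
  assumes "F \<in> faces G p \<gamma>"
  obtains u v w where "(u, v) \<in> parcs G" "(v, w) \<in> parcs G" "(w, u) \<in> parcs G"
    "frontier F = path_image (\<gamma> u v) \<union> path_image (\<gamma> v w) \<union> path_image (\<gamma> w u)" "corners F = {u, v, w}"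
proof -
  obtain u v w where *: "(u, v) \<in> parcs G" "(v, w) \<in> parcs G" "(w, u) \<in> parcs G"
    "frontier F = path_image (\<gamma> u v) \<union> path_image (\<gamma> v w) \<union> path_image (\<gamma> w u)"
    using triangular[OF assms] unfolding bounded_by_triangle_def by blast
  have "corners F \<subseteq> {u, v, w}"
    using * vertex_on_edge[of u v] vertex_on_edge[of v w] vertex_on_edge[of w u] unfolding corners_def by blast
  moreover have "{u, v, w} \<subseteq> corners F"
    using * edge_arc(2)[of u v] edge_arc(2)[of v w] edge_arc(2)[of w u] parcs_subset unfolding corners_def by blast
  ultimately show ?thesis using that * by blast
qed

lemma frontier_subset_subdrawing:
  assumes "F \<in> faces G p \<gamma>" "corners F \<subseteq> W" shows "frontier F \<subseteq> subdrawing W"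
  using assms(1)
proof (cases rule: face_triangleE)
  case (1 u v w)
  then show ?thesis
    using assms(2) subdrawing_edge[of u v W] subdrawing_edge[of v w W] subdrawing_edge[of w u W] by simp
qed

lemma closure_face:
  assumes "F \<in> faces G p \<gamma>" "v \<in> corners F"
  shows "connected (F \<union> frontier F)" "p v \<in> F \<union> frontier F"
  using face_props(1)[OF assms(1)] assms(2) connected_imp_connected_closure[of F] closure_Un_frontier[of F]
  by (auto simp: corners_def)

lemma corners_nonempty: "F \<in> faces G p \<gamma> \<Longrightarrow> corners F \<noteq> {}"
  by (erule face_triangleE) simp

text \<open>Triangularity enters here. It forbids a face with corners in two sets that no edge
  joins, and it makes a corner in \<open>Y\<close> adjacent to both ends of the opposite
  edge.\<close>

lemma corners_adjacent: "F \<in> faces G p \<gamma> \<Longrightarrow> u \<in> corners F \<Longrightarrow> v \<in> corners F \<Longrightarrow> u \<noteq> v \<Longrightarrow> (u, v) \<in> parcs G"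
  by (erule face_triangleE) (use sym_parcs in \<open>auto dest: symD\<close>)

text \<open>If no edge joined \<open>A\<close> to the other vertices, every face would have all its
  corners on one side. The drawings of the two sides, each with its faces, would be disjoint
  nonempty closed sets covering the plane.\<close>

lemma conn_pverts: "conn (parcs G) (pverts G)"
proof (rule conn_cutI[OF sym_parcs], rule ccontr)
  fix A assume A: "A \<subseteq> pverts G" "A \<noteq> {}" "A \<noteq> pverts G"
    and no: "\<not> (\<exists>u\<in>A. \<exists>v\<in>pverts G - A. (u, v) \<in> parcs G)"
  define B where "B = pverts G - A"
  have B: "B \<subseteq> pverts G" "B \<noteq> {}" "A \<inter> B = {}" "A \<union> B = pverts G" using A B_def by auto
  define fill where "fill W = subdrawing W \<union> \<Union>{F \<in> faces G p \<gamma>. corners F \<subseteq> W}" for W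
  have mono: "corners F \<subseteq> A \<or> corners F \<subseteq> B" if "F \<in> faces G p \<gamma>" for F
    using that corners_adjacent[OF that] no unfolding B_def corners_def by blast
  have closed: "closed (fill W)" if "W \<subseteq> pverts G" for W
    unfolding fill_def using that frontier_subset_subdrawing
    by (intro closed_Un_Union_frontier closed_subdrawing) blast+
  have "subdrawing (pverts G) \<subseteq> subdrawing A \<union> subdrawing B"
  proof
    fix x assume "x \<in> subdrawing (pverts G)"
    then show "x \<in> subdrawing A \<union> subdrawing B"
    proof (cases rule: subdrawingE)
      case (1 v)
      then show ?thesis using B subdrawing_vertex by blast
    next
      case (2 u v)
      moreover have "(v, u) \<in> parcs G" using 2(1) sym_parcs by (auto dest: symD)
      ultimately have "{u, v} \<subseteq> A \<or> {u, v} \<subseteq> B" using no unfolding B_def by blast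
      then show ?thesis using 2 subdrawing_edge[of u v A] subdrawing_edge[of u v B] by auto
    qed
  qed
  then have cover: "UNIV \<subseteq> fill A \<union> fill B"
    using faces_cover mono unfolding fill_def by blast
  have "fill A \<inter> fill B = {}"
  proof -
    have "F \<noteq> F'" if "F \<in> faces G p \<gamma>" "corners F \<subseteq> A" "corners F' \<subseteq> B" for F F'
      using that B(3) corners_nonempty[OF that(1)] by blast
    then have "\<Union>{F \<in> faces G p \<gamma>. corners F \<subseteq> A} \<inter> \<Union>{F \<in> faces G p \<gamma>. corners F \<subseteq> B} = {}"
      using faces_disjoint by blast
    moreover have "F \<inter> subdrawing W = {}" if "F \<in> faces G p \<gamma>" "W \<subseteq> pverts G" for F W
      using face_props(2)[OF that(1)] subdrawing_mono[OF that(2)] by blast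
    ultimately show ?thesis
      using subdrawing_disjoint[OF A(1) B(1,3)] A(1) B(1) unfolding fill_def by blast
  qed
  moreover have "fill A \<noteq> {}" "fill B \<noteq> {}" using A(2) B(2) subdrawing_vertex unfolding fill_def by blast+
  ultimately show False
    using cover closed[OF A(1)] closed[OF B(1)] connected_closedD[OF connected_UNIV, of "fill A" "fill B"] by simp
qed

text \<open>By unicoherence of the plane: \<open>KY\<close> consists of everything drawn at \<open>Y\<close> and of the closed
  faces with a corner in \<open>Y\<close>, and \<open>KZ\<close> of the drawing of \<open>Z\<close> and of the remaining closed faces. Both are
  closed and connected, and they cover the plane. Hence their intersection is connected; it contains the
  vertices of \<open>Z\<close> with a neighbour in \<open>Y\<close>, and it lies in the drawing of the subgraph that they
  induce.\<close>

lemma bond: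
  assumes "Y \<noteq> {}" "Z \<noteq> {}" "Y \<inter> Z = {}" "Y \<union> Z = pverts G" "conn (parcs G) Y" "conn (parcs G) Z"
  shows "conn (parcs G) (Z \<inter> parcs G `` Y)"
proof -
  let ?E = "parcs G" and ?N = "Z \<inter> parcs G `` Y"
  have sub: "Y \<subseteq> pverts G" "Z \<subseteq> pverts G" "?N \<subseteq> pverts G" using assms(4) by auto
  define FY where "FY = {F \<in> faces G p \<gamma>. corners F \<inter> Y \<noteq> {}}"
  define FZ where "FZ = {F \<in> faces G p \<gamma>. corners F \<subseteq> Z}"
  \<comment> \<open>The last disjunct admits edges with both ends in \<open>Z\<close> that bound a
    face of \<open>FY\<close>. They put the frontiers of these faces into \<open>DY\<close> and so
    make \<open>KY\<close> closed.\<close>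
  define EY where "EY = {(u, v) \<in> ?E. u \<in> Y \<or> v \<in> Y \<or> (\<exists>F\<in>FY. u \<in> corners F \<and> v \<in> corners F \<and> path_image (\<gamma> u v) \<subseteq> frontier F)}"
  define DY where "DY = p ` Y \<union> (\<Union>(u, v)\<in>EY. path_image (\<gamma> u v))"
  define KY where "KY = DY \<union> \<Union>FY"
  define KZ where "KZ = subdrawing Z \<union> \<Union>FZ"
  have faces: "F \<in> FY \<or> F \<in> FZ" if "F \<in> faces G p \<gamma>" for F
    using that assms(4) unfolding FY_def FZ_def corners_def by blast
  have "closed DY"
    unfolding DY_def
  proof (intro closed_Un)
    show "closed (p ` Y)" using finite_subset[OF sub(1) finite_pverts] by (simp add: finite_imp_closed)
    show "closed (\<Union>(u, v)\<in>EY. path_image (\<gamma> u v))"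
      using finite_parcs edge_closed_connected(1)
      by (intro closed_UN) (auto simp: EY_def intro: finite_subset[of _ ?E])
  qed
  have frontier_DY: "frontier F \<subseteq> DY" if F: "F \<in> FY" for F
  proof -
    have "F \<in> faces G p \<gamma>" using F FY_def by blast
    then obtain u v w where t: "(u, v) \<in> ?E" "(v, w) \<in> ?E" "(w, u) \<in> ?E"
      "frontier F = path_image (\<gamma> u v) \<union> path_image (\<gamma> v w) \<union> path_image (\<gamma> w u)" "corners F = {u, v, w}"
      by (rule face_triangleE)
    then have "(u, v) \<in> EY" "(v, w) \<in> EY" "(w, u) \<in> EY" unfolding EY_def using F by blast+
    then show ?thesis unfolding t(4) DY_def by blast
  qed
  have "closed KY" unfolding KY_def using \<open>closed DY\<close> frontier_DY by (rule closed_Un_Union_frontier)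
  have frontier_Z: "frontier F \<subseteq> subdrawing Z" if "F \<in> FZ" for F
    using that frontier_subset_subdrawing unfolding FZ_def by blast
  then have "closed KZ" unfolding KZ_def using closed_subdrawing[OF sub(2)]
    by (intro closed_Un_Union_frontier) auto
  have subY: "subdrawing Y \<subseteq> DY" unfolding subdrawing_def DY_def EY_def by auto
  have faceY: "\<exists>K\<subseteq>KY. connected K \<and> x \<in> K \<and> K \<inter> subdrawing Y \<noteq> {}"
    if F: "F \<in> FY" and x: "x \<in> F \<union> frontier F" for F x
  proof -
    obtain y where y: "y \<in> Y" "y \<in> corners F" "F \<in> faces G p \<gamma>" using F FY_def by blast
    then show ?thesis
      using closure_face[OF y(3,2)] x F frontier_DY[OF F] subdrawing_vertex[OF y(1)] unfolding KY_def
      by (intro exI[of _ "F \<union> frontier F"]) blast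
  qed
  have "connected KY"
  proof (rule connected_attachI[OF connected_subdrawing[OF assms(5)]])
    show "subdrawing Y \<subseteq> KY" using subY KY_def by blast
    fix x assume "x \<in> KY"
    then consider y where "y \<in> Y" "x = p y" | u v where "(u, v) \<in> ?E" "x \<in> path_image (\<gamma> u v)" "u \<in> Y \<or> v \<in> Y"
      | F where "F \<in> FY" "x \<in> F \<union> frontier F"
      unfolding KY_def DY_def EY_def by blast
    then show "\<exists>K\<subseteq>KY. connected K \<and> x \<in> K \<and> K \<inter> subdrawing Y \<noteq> {}"
    proof cases
      case (1 y)
      then show ?thesis using subdrawing_vertex[of y Y] by (intro exI[of _ "{x}"]) (auto simp: KY_def DY_def)
    next
      case (2 u v)
      then have "path_image (\<gamma> u v) \<subseteq> KY" unfolding KY_def DY_def EY_def by blast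
      moreover have "path_image (\<gamma> u v) \<inter> subdrawing Y \<noteq> {}"
        using 2 edge_arc(2,3)[of u v] subdrawing_vertex[of u Y] subdrawing_vertex[of v Y] by blast
      ultimately show ?thesis using 2 edge_closed_connected(2)[of u v] by blast
    next
      case (3 F)
      then show ?thesis by (rule faceY)
    qed
  qed
  have "connected KZ"
  proof (rule connected_attachI[OF connected_subdrawing[OF assms(6)]])
    show "subdrawing Z \<subseteq> KZ" using KZ_def by blast
    fix x assume "x \<in> KZ"
    then consider "x \<in> subdrawing Z" | F where "F \<in> FZ" "x \<in> F" unfolding KZ_def by blast
    then show "\<exists>K\<subseteq>KZ. connected K \<and> x \<in> K \<and> K \<inter> subdrawing Z \<noteq> {}"
    proof cases
      case 1
      then show ?thesis unfolding KZ_def by (intro exI[of _ "{x}"]) auto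
    next
      case (2 F)
      then have F: "F \<in> faces G p \<gamma>" "corners F \<subseteq> Z" unfolding FZ_def by auto
      then obtain z where z: "z \<in> corners F" using corners_nonempty by blast
      then show ?thesis
        using closure_face[OF F(1) z] 2 frontier_Z[OF 2(1)] subdrawing_vertex[of z Z] F(2) unfolding KZ_def
        by (intro exI[of _ "F \<union> frontier F"]) blast
    qed
  qed
  have "DY \<subseteq> subdrawing (pverts G)"
    unfolding DY_def EY_def subdrawing_def using sub(1) parcs_subset by blast
  note drawn = this subdrawing_mono[OF sub(2)]
  have "subdrawing (pverts G) \<subseteq> DY \<union> subdrawing Z"
  proof
    fix x assume "x \<in> subdrawing (pverts G)"
    then show "x \<in> DY \<union> subdrawing Z"
    proof (cases rule: subdrawingE)
      case (1 v)
      then show ?thesis using assms(4) unfolding DY_def subdrawing_def by blast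
    next
      case (2 u v)
      then show ?thesis using assms(4) unfolding DY_def EY_def subdrawing_def by blast
    qed
  qed
  then have "KY \<union> KZ = UNIV" unfolding KY_def KZ_def using faces_cover faces by blast
  then have conn: "connected (KY \<inter> KZ)"
    using \<open>connected KY\<close> \<open>connected KZ\<close> \<open>closed KY\<close> \<open>closed KZ\<close>
    by (intro unicoherentD[OF convex_imp_unicoherent[OF convex_UNIV], of KY KZ]) auto
  have N_sub: "p ` ?N \<subseteq> KY \<inter> KZ"
  proof -
    have "p v \<in> KY \<inter> KZ" if "v \<in> Z" "y \<in> Y" "(y, v) \<in> ?E" for y v
      using edge_arc(3)[OF that(3)] that subdrawing_vertex[of v Z]
      unfolding KY_def KZ_def DY_def EY_def by blast
    then show ?thesis by blast
  qed
  \<comment> \<open>An edge with an end in \<open>Y\<close> can meet the drawing of \<open>Z\<close>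
    only at its other end, which is then a vertex of \<open>?N\<close>.\<close>
  have edge_case: "x \<in> subdrawing ?N"
    if "(u, v) \<in> ?E" "x \<in> path_image (\<gamma> u v)" "u \<in> Y" "x \<in> subdrawing Z" for x u v
    using that(4)
  proof (cases rule: subdrawingE)
    case (1 z)
    then have "z = v" using vertex_on_edge[OF that(1), of z] that(2,3) assms(3) sub(2) by blast
    then have "x = p v" "v \<in> ?N" using 1 that(1,3) by auto
    then show ?thesis by (simp only: subdrawing_vertex)
  next
    case (2 a b)
    have "u \<notin> {a, b}" using 2(2,3) that(3) assms(3) by blast
    then have "{u, v} \<noteq> {a, b}" by blast
    then have "x \<in> p ` ({u, v} \<inter> {a, b})" using edges_meet[OF that(1) 2(1)] that(2) 2(4) by blast
    then have "x = p v" "v \<in> ?N" using 2(2,3) \<open>u \<notin> {a, b}\<close> that(1,3) by auto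
    then show ?thesis by (simp only: subdrawing_vertex)
  qed
  have meet: "KY \<inter> KZ \<subseteq> subdrawing ?N"
  proof
    fix x assume x: "x \<in> KY \<inter> KZ"
    \<comment> \<open>Faces avoid the drawing, and \<open>FY\<close> and \<open>FZ\<close> have no
      face in common, so \<open>KY\<close> and \<open>KZ\<close> overlap only in drawn
      points.\<close>
    have "x \<in> DY \<inter> subdrawing Z"
    proof (rule ccontr)
      assume *: "x \<notin> DY \<inter> subdrawing Z"
      have "F \<inter> DY = {}" "F \<inter> subdrawing Z = {}" if "F \<in> faces G p \<gamma>" for F
        using face_props(2)[OF that] drawn by blast+
      then obtain F F' where F: "F \<in> FY" "x \<in> F" "F' \<in> FZ" "x \<in> F'"
        using x * unfolding KY_def KZ_def FY_def FZ_def by blast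
      then have "F = F'" using faces_disjoint unfolding FY_def FZ_def by blast
      then show False using F assms(3) unfolding FY_def FZ_def by blast
    qed
    then have xZ: "x \<in> subdrawing Z" and "x \<in> DY" by auto
    from \<open>x \<in> DY\<close> consider y where "y \<in> Y" "x = p y" | u v where "(u, v) \<in> EY" "x \<in> path_image (\<gamma> u v)"
      unfolding DY_def by blast
    then show "x \<in> subdrawing ?N"
    proof cases
      case (1 y)
      then have "x \<in> subdrawing Y" by (simp add: subdrawing_vertex)
      then show ?thesis using subdrawing_disjoint[OF sub(1,2) assms(3)] xZ by blast
    next
      case (2 u v)
      then have uv: "(u, v) \<in> ?E" "(v, u) \<in> ?E" using sym_parcs unfolding EY_def by (auto dest: symD)
      consider "u \<in> Y" | "v \<in> Y" | "u \<in> Z" "v \<in> Z" "\<exists>F\<in>FY. u \<in> corners F \<and> v \<in> corners F"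
        using 2(1) assms(4) parcs_subset unfolding EY_def by blast
      then show ?thesis
      proof cases
        case 1
        then show ?thesis using edge_case[OF uv(1) 2(2)] xZ by blast
      next
        case _: 2
        then show ?thesis using edge_case[OF uv(2)] edge_arc(4)[OF uv(1)] 2(2) xZ by blast
      next
        case 3
        then obtain F y where F: "F \<in> faces G p \<gamma>" "u \<in> corners F" "v \<in> corners F" "y \<in> corners F" "y \<in> Y"
          unfolding FY_def by blast
        then have "(y, u) \<in> ?E" "(y, v) \<in> ?E"
          using corners_adjacent[OF F(1) F(4)] 3 assms(3) by blast+
        then have "u \<in> ?N" "v \<in> ?N" using F(5) 3(1,2) by auto
        then show ?thesis using subdrawing_edge[OF uv(1), of ?N] 2(2) by (simp only: subset_iff)
      qed
    qed
  qed
  show ?thesis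
  proof (rule conn_cutI[OF sym_parcs], rule ccontr)
    fix A assume A: "A \<subseteq> ?N" "A \<noteq> {}" "A \<noteq> ?N" and no: "\<not> (\<exists>u\<in>A. \<exists>v\<in>?N - A. (u, v) \<in> ?E)"
    define B where "B = ?N - A"
    have AB: "A \<subseteq> pverts G" "B \<subseteq> pverts G" "A \<inter> B = {}" "B \<noteq> {}" "B \<subseteq> ?N" using A sub(3) B_def by auto
    have N: "?N = A \<union> B" using A(1) B_def by blast
    have "subdrawing ?N \<subseteq> subdrawing A \<union> subdrawing B"
    proof
      fix x assume "x \<in> subdrawing ?N"
      then show "x \<in> subdrawing A \<union> subdrawing B"
      proof (cases rule: subdrawingE)
        case (1 v)
        then show ?thesis unfolding N using subdrawing_vertex by blast
      next
        case (2 u v)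
        moreover have "(v, u) \<in> ?E" using 2(1) sym_parcs by (auto dest: symD)
        ultimately have "u \<in> A \<and> v \<in> A \<or> u \<in> B \<and> v \<in> B" using no unfolding B_def[symmetric] N by blast
        then show ?thesis using 2 subdrawing_edge[of u v A] subdrawing_edge[of u v B] by blast
      qed
    qed
    \<comment> \<open>\<open>KY \<inter> KZ\<close> contains the vertices of \<open>?N\<close> and
      lies in the drawing they induce. Hence the two halves cover this connected set, and each of
      them meets it.\<close>
    then have "KY \<inter> KZ \<subseteq> subdrawing A \<union> subdrawing B" using meet by blast
    moreover have "subdrawing A \<inter> (KY \<inter> KZ) \<noteq> {}" "subdrawing B \<inter> (KY \<inter> KZ) \<noteq> {}"
      using N_sub A(2) AB(4) subdrawing_vertex[of _ A] subdrawing_vertex[of _ B] unfolding N by blast+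
    moreover have "subdrawing A \<inter> subdrawing B \<inter> (KY \<inter> KZ) = {}"
      using subdrawing_disjoint[OF AB(1,2,3)] by blast
    ultimately show False
      using connected_closedD[OF conn _ _ closed_subdrawing[OF AB(1)] closed_subdrawing[OF AB(2)]] by blast
  qed
qed

sublocale bond_graph "pverts G" "parcs G"
  by unfold_locales (use finite_pverts sym_parcs parcs_subset conn_pverts bond in blast)+

end

section \<open>Trees and treewidth\<close>

lemma rtrancl_on_Restr: "(x, y) \<in> rtrancl_on S E \<Longrightarrow> (x, y) \<in> rtrancl_on S (Restr E S)"
  by (induction rule: rtrancl_on_induct) (auto intro: rtrancl_on_into_rtrancl_on)

lemma conn_Restr: "conn (Restr E S) S \<longleftrightarrow> conn E S"
proof
  assume "conn (Restr E S) S"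
  moreover have "(x, y) \<in> rtrancl_on S (Restr E S) \<Longrightarrow> (x, y) \<in> rtrancl_on S E" for x y
    by (rule rtrancl_on_mono[of "Restr E S" E S S x y]) auto
  ultimately show "conn E S" unfolding conn_def by blast
next
  assume "conn E S"
  then show "conn (Restr E S) S" unfolding conn_def using rtrancl_on_Restr[of _ _ S E] by blast
qed

text \<open>The library notion takes the symmetric closure of the arcs and demands a nonempty vertex
  set; for symmetric arcs only the second point differs from \<open>conn\<close>.\<close>

lemma connected_induce_iff:
  assumes "sym (parcs G)"
  shows "Digraph_Component.connected (with_proj G \<restriction> S) \<longleftrightarrow> S \<noteq> {} \<and> conn (parcs G) S"
proof -
  have "arcs_ends (with_proj G \<restriction> S) = Restr (parcs G) S"
    by (auto simp: arcs_ends_conv induce_subgraph_def)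
  moreover have "symcl (Restr (parcs G) S) = Restr (parcs G) S"
    using assms by (auto simp: symcl_def dest: symD)
  ultimately show ?thesis
    by (simp add: connected_conv conn_def[symmetric] conn_Restr)
qed

lemma connected_with_proj_iff:
  assumes "sym (parcs G)"
  shows "Digraph_Component.connected (with_proj G) \<longleftrightarrow> pverts G \<noteq> {} \<and> conn (parcs G) (pverts G)"
proof -
  have "symcl (parcs G) = parcs G" using assms by (auto simp: symcl_def dest: symD)
  then show ?thesis by (simp add: connected_conv conn_def)
qed

text \<open>The path is extended at its front; when the new vertex already lies on it, everything
  before that vertex is dropped instead.\<close>

lemma rtrancl_on_vpath:
  assumes "(x, y) \<in> rtrancl_on S (parcs G)" "S \<subseteq> pverts G"
  obtains p where "vpath p (with_proj G)" "hd p = x" "last p = y" "set p \<subseteq> S"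
proof -
  have "\<exists>p. vpath p (with_proj G) \<and> hd p = x \<and> last p = y \<and> set p \<subseteq> S"
    using assms(1)
  proof (induction rule: converse_rtrancl_on_induct)
    case base
    then show ?case using assms(2) by (intro exI[of _ "[y]"]) (auto simp: vpath_def vwalk_def)
  next
    case (step x z)
    then obtain p where p: "vwalk p (with_proj G)" "distinct p" "hd p = z" "last p = y" "set p \<subseteq> S"
      by (auto simp: vpath_def)
    show ?case
    proof (cases "x \<in> set p")
      case True
      then obtain q q' where q: "p = q @ x # q'" by (meson split_list)
      have "vwalk (x # q') (with_proj G)"
        using p(1) set_vwalk_arcs_append2[of "x # q'" q] unfolding q vwalk_def by auto
      then show ?thesis using p unfolding q by (intro exI[of _ "x # q'"]) (auto simp: vpath_def)
    next
      case False
      have "x \<in> pverts G" using step assms(2) by blast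
      then have "vwalk (x # p) (with_proj G)"
        using p(1,3) step by (intro vwalk_consI) auto
      moreover have "p \<noteq> []" using p(1) by (auto simp: vwalk_def)
      ultimately show ?thesis using p step False by (intro exI[of _ "x # p"]) (auto simp: vpath_def)
    qed
  qed
  then show ?thesis using that by blast
qed

text \<open>A rooted tree described by depths: each node other than the root has exactly one
  shallower neighbour. This form is easy to check for the tree of layers, and every
  \<open>utree\<close> has it for the distance from a root, so acyclicity and the Helly property are
  proved from the same axioms.\<close>

locale depth_tree =
  fixes T :: "'t pair_pre_digraph" and rt :: 't and depth :: "'t \<Rightarrow> nat"
  assumes finite_nodes: "finite (pverts T)" and arcs_nodes: "parcs T \<subseteq> pverts T \<times> pverts T"
    and sym_arcs: "sym (parcs T)" and root_node: "rt \<in> pverts T"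
    and depth_eq_0_iff: "x \<in> pverts T \<Longrightarrow> depth x = 0 \<longleftrightarrow> x = rt"
    and depth_arc: "(x, y) \<in> parcs T \<Longrightarrow> depth x = Suc (depth y) \<or> depth y = Suc (depth x)"
    and parent_exists: "x \<in> pverts T \<Longrightarrow> x \<noteq> rt \<Longrightarrow> \<exists>y. (x, y) \<in> parcs T \<and> depth y < depth x"
    and parent_unique: "(x, y) \<in> parcs T \<Longrightarrow> (x, z) \<in> parcs T \<Longrightarrow> depth y < depth x \<Longrightarrow> depth z < depth x \<Longrightarrow> y = z"
begin

text \<open>A path that moves away from the root keeps doing so: to turn back it would have to step
  to the parent, which is the node it came from.\<close>

lemma depth_last_vpath: "vpath (x # y # p) (with_proj T) \<Longrightarrow> depth x < depth y \<Longrightarrow> depth x < depth (last (y # p))"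
proof (induction p arbitrary: x y)
  case (Cons z p)
  then have xy: "(x, y) \<in> parcs T" "(y, z) \<in> parcs T" "x \<noteq> z" and path: "vpath (y # z # p) (with_proj T)"
    by (auto simp: vpath_def vwalk_def)
  have "\<not> depth z < depth y"
    using parent_unique[of y x z] xy Cons.prems(2) sym_arcs by (auto dest: symD)
  then have "depth y < depth z" using depth_arc[OF xy(2)] by auto
  then show ?case using Cons.IH[OF path] Cons.prems(2) by simp
qed simp

lemma parent_of_depth:
  assumes "parent_of T rt y x"
  shows "(x, y) \<in> parcs T" "depth y < depth x"
proof -
  obtain p where p: "vpath (x # y # p) (with_proj T)" "last (y # p) = rt"
    using assms by (auto simp: parent_of_def)
  show xy: "(x, y) \<in> parcs T" using p(1) by (auto simp: vpath_def vwalk_def)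
  have "depth rt = 0" using depth_eq_0_iff root_node by blast
  then have "\<not> depth x < depth y" using depth_last_vpath[OF p(1)] p(2) by auto
  then show "depth y < depth x" using depth_arc[OF xy] by auto
qed

lemma conn_nodes: "conn (parcs T) (pverts T)"
proof (rule conn_fromI[OF sym_arcs, where x = rt])
  fix x assume "x \<in> pverts T"
  then show "(rt, x) \<in> rtrancl_on (pverts T) (parcs T)"
  proof (induction "depth x" arbitrary: x rule: less_induct)
    case less
    show ?case
    proof (cases "x = rt")
      case False
      then obtain y where y: "(x, y) \<in> parcs T" "depth y < depth x" using parent_exists less by blast
      then have "(rt, y) \<in> rtrancl_on (pverts T) (parcs T)" using less arcs_nodes by blast
      moreover have "(y, x) \<in> parcs T" using y sym_arcs by (auto dest: symD)
      ultimately show ?thesis using less.prems by (rule rtrancl_on_into_rtrancl_on)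
    qed (use root_node in simp)
  qed
qed

text \<open>If the first step went deeper, the last node would be deeper than the second and thus
  not adjacent to the first. Rotating a cycle therefore lowers the depth of its head forever, which
  is the descent in \<open>no_ucycle\<close>.\<close>

lemma ucycle_depth_hd: assumes "ucycle T p" shows "depth (hd (rotate1 p)) < depth (hd p)"
proof -
  have p: "vwalk p (with_proj T)" "distinct p" "3 \<le> length p" "(last p, hd p) \<in> parcs T"
    using assms by (auto simp: ucycle_def vpath_def)
  obtain a b c q where q: "p = a # b # c # q"
    using p(3) by (cases p rule: remdups_adj.cases; cases "tl (tl p)") auto
  have ab: "(a, b) \<in> parcs T" and bc: "(b, c) \<in> parcs T" and "a \<noteq> c"
    and path: "vpath (b # c # q) (with_proj T)" and last: "(last (c # q), a) \<in> parcs T"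
    using p by (auto simp: q vpath_def vwalk_def)
  have "\<not> depth a < depth b"
  proof
    assume "depth a < depth b"
    then have "depth b < depth c"
      using parent_unique[of b a c] ab bc \<open>a \<noteq> c\<close> sym_arcs depth_arc[OF bc] by (auto dest: symD)
    then have "depth b < depth (last (c # q))" using depth_last_vpath[OF path] by blast
    then show False using depth_arc[OF last] \<open>depth a < depth b\<close> by linarith
  qed
  then show ?thesis using depth_arc[OF ab] by (auto simp: q)
qed

lemma ucycle_rotate1: assumes "ucycle T p" shows "ucycle T (rotate1 p)"
proof -
  have p: "vwalk p (with_proj T)" "distinct p" "3 \<le> length p" "(last p, hd p) \<in> parcs T"
    using assms by (auto simp: ucycle_def vpath_def)
  obtain a b q where q: "p = a # b # q"
    using p(3) by (cases p rule: remdups_adj.cases) auto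
  have "vwalk_arcs ((b # q) @ [a]) = vwalk_arcs (b # q) @ [(last (b # q), a)]"
    by (subst vwalk_arcs_append) auto
  then show ?thesis using p unfolding q ucycle_def vpath_def vwalk_def by auto
qed

lemma no_ucycle: "\<not> ucycle T p"
proof (induction "depth (hd p)" arbitrary: p rule: less_induct)
  case less
  then show ?case using ucycle_depth_hd ucycle_rotate1 by blast
qed

lemma utree: "utree T"
proof -
  have "(x, x) \<notin> parcs T" for x using depth_arc[of x x] by auto
  then have "pair_graph T" using finite_nodes arcs_nodes sym_arcs by (intro pair_graphI)
  then show ?thesis
    unfolding utree_def connected_with_proj_iff[OF sym_arcs] using no_ucycle conn_nodes root_node by blast
qed

text \<open>A path in \<open>S\<close> from \<open>x\<close> to \<open>t\<close> cannot start by
  going deeper, for it would then end deeper than \<open>x\<close>, whereas \<open>t\<close> has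
  least depth in \<open>S\<close>.\<close>

lemma parent_in_conn:
  assumes "conn (parcs T) S" "S \<subseteq> pverts T" "t \<in> S" "x \<in> S" "x \<noteq> t" "\<And>s. s \<in> S \<Longrightarrow> depth t \<le> depth s"
  obtains y where "y \<in> S" "(x, y) \<in> parcs T" "depth y < depth x"
proof -
  have "(x, t) \<in> rtrancl_on S (parcs T)" using assms by (auto simp: conn_def)
  then obtain p where p: "vpath p (with_proj T)" "hd p = x" "last p = t" "set p \<subseteq> S"
    using assms(2) by (rule rtrancl_on_vpath)
  then obtain y q where q: "p = x # y # q"
    using assms(5) by (cases p rule: remdups_adj.cases) (auto simp: vpath_def vwalk_def)
  have xy: "(x, y) \<in> parcs T" using p by (auto simp: q vpath_def vwalk_def)
  have "\<not> depth x < depth y" using depth_last_vpath[of x y q] p assms(4,6) unfolding q by fastforce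
  then have "depth y < depth x" using depth_arc[OF xy] by auto
  then show ?thesis using that[of y] xy p(4) unfolding q by simp
qed

text \<open>The common node is the top of the subtree whose top is deepest.\<close>

lemma helly:
  assumes "\<S> \<noteq> {}" and subtrees: "\<And>S. S \<in> \<S> \<Longrightarrow> S \<subseteq> pverts T \<and> S \<noteq> {} \<and> conn (parcs T) S"
    and meet: "\<And>S S'. S \<in> \<S> \<Longrightarrow> S' \<in> \<S> \<Longrightarrow> S \<inter> S' \<noteq> {}"
  obtains t where "t \<in> pverts T" "\<And>S. S \<in> \<S> \<Longrightarrow> t \<in> S"
proof -
  have fin: "finite \<S>" "\<And>S. S \<in> \<S> \<Longrightarrow> finite S"
    using subtrees finite_nodes by (auto intro: finite_subset[of _ "Pow (pverts T)"] finite_subset)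
  define top where "top S = Min (depth ` S)" for S
  have top_le: "top S \<le> depth s" if "S \<in> \<S>" "s \<in> S" for S s
    unfolding top_def using that fin by simp
  have top: "\<exists>t\<in>S. depth t = top S" if "S \<in> \<S>" for S
    using Min_in[of "depth ` S"] that fin(2) subtrees unfolding top_def by fastforce
  have "Max (top ` \<S>) \<in> top ` \<S>" using fin assms(1) by (intro Max_in) auto
  then obtain S where S: "S \<in> \<S>" "top S = Max (top ` \<S>)" by force
  then have S_max: "top S' \<le> top S" if "S' \<in> \<S>" for S' using fin that by simp
  obtain t where t: "t \<in> S" "depth t = top S" using top[OF S(1)] by blast
  have "t \<in> S'" if S': "S' \<in> \<S>" for S'
  proof -
    \<comment> \<open>A shallowest common node \<open>u\<close> must be the top of \<open>S\<close>.
      Otherwise its parent lies in \<open>S\<close>, and also in \<open>S'\<close>, whose top is no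
      deeper than that of \<open>S\<close>, and is a shallower common node.\<close>
    obtain u where u: "u \<in> S \<inter> S'" "\<And>s. s \<in> S \<inter> S' \<Longrightarrow> depth u \<le> depth s"
      using ex_min_if_finite[of "depth ` (S \<inter> S')"] meet[OF S(1) S'] fin(2)[OF S'] by (force simp: not_less)
    have "u = t"
    proof (rule ccontr)
      assume "u \<noteq> t"
      then obtain y where y: "y \<in> S" "(u, y) \<in> parcs T" "depth y < depth u"
        using parent_in_conn[of S t u] subtrees[OF S(1)] t u top_le[OF S(1)] by auto
      obtain t' where t': "t' \<in> S'" "depth t' = top S'" using top[OF S'] by blast
      have "u \<noteq> t'" using y top_le[OF S(1) y(1)] S_max[OF S'] t' by auto
      then obtain y' where "y' \<in> S'" "(u, y') \<in> parcs T" "depth y' < depth u"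
        using parent_in_conn[of S' t' u] subtrees[OF S'] t' u top_le[OF S'] by auto
      then have "y \<in> S \<inter> S'" using parent_unique[OF y(2) _ y(3)] y(1) by auto
      then show False using u(2) y(3) by force
    qed
    then show ?thesis using u by blast
  qed
  then show ?thesis using that[of t] t subtrees[OF S(1)] by blast
qed

end

text \<open>Two neighbours of \<open>x\<close> that are no farther from \<open>rt\<close> than
  \<open>x\<close> could be joined by a path avoiding \<open>x\<close>, and this path would close up
  to a cycle through \<open>x\<close>.\<close>

lemma depth_tree_of_utree:
  assumes "utree T" "rt \<in> pverts T"
  shows "depth_tree T rt (lev (parcs T) {rt})"
proof -
  have pg: "pair_graph T" and acyclic: "\<And>p. \<not> ucycle T p" using assms by (auto simp: utree_def)
  have sym: "sym (parcs T)" using pair_graph_sym[OF pg] .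
  have sub: "parcs T \<subseteq> pverts T \<times> pverts T" using pair_graph_parcs_subset[OF pg] .
  interpret connected_graph "pverts T" "parcs T"
    using assms(1) connected_with_proj_iff[OF sym] pair_graph_finite[OF pg] sub sym
    by unfold_locales (auto simp: utree_def)
  let ?d = "lev (parcs T) {rt}"
  have r: "{rt} \<noteq> {}" "{rt} \<subseteq> pverts T" using assms by auto
  have irrefl: "(x, x) \<notin> parcs T" for x
    using pg unfolding pair_graph_def pair_digraph_def pair_loopfree_digraph_def pair_loopfree_digraph_axioms_def
    by fastforce
  \<comment> \<open>The comparisons are not strict, so that arcs between nodes at equal distance are
    excluded as well, as \<open>depth_arc\<close> demands.\<close>
  have unique: "y = z" if yz: "(x, y) \<in> parcs T" "(x, z) \<in> parcs T" "?d y \<le> ?d x" "?d z \<le> ?d x" for x y z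
  proof (rule ccontr)
    assume "y \<noteq> z"
    let ?S = "{u \<in> pverts T. ?d u \<le> ?d x} - {x}"
    have x: "x \<in> pverts T" "x \<noteq> rt"
    proof -
      show "x \<in> pverts T" using yz sub by auto
      show "x \<noteq> rt"
      proof
        assume "x = rt"
        then have "?d x = 0" using lev_eq_0_iff[OF r] assms by simp
        then have "y = rt" using yz sub lev_eq_0_iff[OF r, of y] by auto
        then show False using yz(1) \<open>x = rt\<close> irrefl by blast
      qed
    qed
    \<comment> \<open>Predecessors of nodes in the ball are closer to \<open>rt\<close> than
      \<open>x\<close> is, so removing \<open>x\<close> leaves the ball connected.\<close>
    have "(rt, u) \<in> rtrancl_on ?S (parcs T)" if "u \<in> ?S" for u
      using that
    proof (induction "?d u" arbitrary: u)
      case 0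
      then have "u = rt" using lev_eq_0_iff[OF r, of u] by auto
      then show ?case using 0 by simp
    next
      case (Suc n)
      have u: "u \<in> pverts T" "?d u = Suc n" using Suc by auto
      obtain v where v: "(v, u) \<in> parcs T" "v \<in> pverts T" "?d v = n"
        using lev_predecessor[OF r u] by metis
      have "v \<in> ?S" using v u Suc.prems by auto
      then have "(rt, v) \<in> rtrancl_on ?S (parcs T)" using Suc(1) v(3) by simp
      then show ?case using v(1) Suc.prems by (rule rtrancl_on_into_rtrancl_on)
    qed
    then have "conn (parcs T) ?S" by (rule conn_fromI[OF sym])
    moreover have "y \<in> ?S" "z \<in> ?S" using yz sub irrefl by auto
    ultimately have "(y, z) \<in> rtrancl_on ?S (parcs T)" by (simp add: conn_def)
    then obtain p where p: "vpath p (with_proj T)" "hd p = y" "last p = z" "set p \<subseteq> ?S"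
      by (rule rtrancl_on_vpath) auto
    then obtain y' q where q: "p = y # y' # q"
      using \<open>y \<noteq> z\<close> by (cases p rule: remdups_adj.cases) (auto simp: vpath_def vwalk_def)
    have "vpath (x # p) (with_proj T)"
      using p x yz(1) by (auto simp: vpath_def intro!: vwalk_consI)
    moreover have "(last (x # p), hd (x # p)) \<in> parcs T" using p(3) q yz(2) sym by (auto dest: symD)
    ultimately have "ucycle T (x # p)" by (simp add: ucycle_def q)
    then show False using acyclic by blast
  qed
  have parent: "\<exists>y. (x, y) \<in> parcs T \<and> ?d y < ?d x" if x: "x \<in> pverts T" "x \<noteq> rt" for x
  proof -
    have "?d x \<noteq> 0" using x lev_eq_0_iff[OF r, of x] by simp
    then obtain n where "?d x = Suc n" using not0_implies_Suc by blast
    then obtain u where "(u, x) \<in> parcs T" "?d u = n" using lev_predecessor[OF r x(1)] by metis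
    then show ?thesis using \<open>?d x = Suc n\<close> sym by (auto dest: symD)
  qed
  show ?thesis
  proof
    fix x y assume xy: "(x, y) \<in> parcs T"
    then have yx: "(y, x) \<in> parcs T" using sym by (auto dest: symD)
    have "?d x \<noteq> ?d y"
    proof
      assume eq: "?d x = ?d y"
      show False
      proof (cases "x = rt")
        case True
        then have "y = rt" using eq lev_eq_0_iff[OF r, of x] lev_eq_0_iff[OF r, of y] xy sub by auto
        then show False using True xy irrefl by blast
      next
        case False
        then obtain z where z: "(x, z) \<in> parcs T" "?d z < ?d x" using parent xy sub by blast
        then have "y = z" using unique[OF xy z(1)] eq by simp
        then show False using z eq by simp
      qed
    qed
    then show "?d x = Suc (?d y) \<or> ?d y = Suc (?d x)"
      using lev_edge[OF r xy] lev_edge[OF r yx] by linarith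
  qed (use fin edges sym assms lev_eq_0_iff[OF r] parent unique in \<open>auto\<close>)
qed

section \<open>Brambles and the width of decompositions\<close>

definition bag_nodes :: "'t pair_pre_digraph \<Rightarrow> ('t \<Rightarrow> 'a set) \<Rightarrow> 'a set \<Rightarrow> 't set" where
  "bag_nodes T B S = {t \<in> pverts T. B t \<inter> S \<noteq> {}}"

text \<open>Some bag contains both ends of any given edge, so the subtrees of adjacent vertices
  share a node; along a path in \<open>S\<close> they link up.\<close>

lemma conn_bag_nodes:
  assumes td: "tree_decomposition T B G" and S: "conn (parcs G) S" "S \<subseteq> pverts G" "S \<noteq> {}"
  shows "conn (parcs T) (bag_nodes T B S)" "bag_nodes T B S \<noteq> {}"
proof -
  have sym: "sym (parcs T)" using td pair_graph_sym by (auto simp: tree_decomposition_def utree_def)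
  have vertex: "conn (parcs T) {t \<in> pverts T. v \<in> B t}" "{t \<in> pverts T. v \<in> B t} \<noteq> {}" if "v \<in> pverts G" for v
    using td that by (auto simp: tree_decomposition_def connected_induce_iff[OF sym])
  obtain s\<^sub>0 where s\<^sub>0: "s\<^sub>0 \<in> S" using S by blast
  then obtain t\<^sub>0 where t\<^sub>0: "t\<^sub>0 \<in> pverts T" "s\<^sub>0 \<in> B t\<^sub>0" using vertex(2) S by blast
  then show "bag_nodes T B S \<noteq> {}" using s\<^sub>0 by (auto simp: bag_nodes_def)
  let ?R = "rtrancl_on (bag_nodes T B S) (parcs T)"
  have within: "(t, t') \<in> ?R" if "v \<in> S" "t \<in> pverts T" "v \<in> B t" "t' \<in> pverts T" "v \<in> B t'" for v t t'
  proof -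
    have "(t, t') \<in> rtrancl_on {t \<in> pverts T. v \<in> B t} (parcs T)"
      using vertex(1)[of v] that S(2) by (auto simp: conn_def)
    then show ?thesis by (rule rtrancl_on_subset[rotated]) (use that in \<open>auto simp: bag_nodes_def\<close>)
  qed
  have reach: "\<forall>t\<in>pverts T. s \<in> B t \<longrightarrow> (t\<^sub>0, t) \<in> ?R" if "(s\<^sub>0, s) \<in> rtrancl_on S (parcs G)" for s
    using that
  proof (induction rule: rtrancl_on_induct)
    case base
    then show ?case using within[OF s\<^sub>0 t\<^sub>0] by blast
  next
    case (step y z)
    then obtain t' where t': "t' \<in> pverts T" "y \<in> B t'" "z \<in> B t'"
      using td unfolding tree_decomposition_def by blast
    then have "(t\<^sub>0, t') \<in> ?R" using step by blast
    then show ?case using within[OF step(4) t'(1,3)] by (blast intro: rtrancl_on_trans)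
  qed
  show "conn (parcs T) (bag_nodes T B S)"
  proof (rule conn_fromI[OF sym, where x = t\<^sub>0])
    fix t assume "t \<in> bag_nodes T B S"
    then obtain s where "s \<in> S" "t \<in> pverts T" "s \<in> B t" by (auto simp: bag_nodes_def)
    moreover have "(s\<^sub>0, s) \<in> rtrancl_on S (parcs G)" using S(1) s\<^sub>0 \<open>s \<in> S\<close> by (simp add: conn_def)
    ultimately show "(t\<^sub>0, t) \<in> ?R" using reach by blast
  qed
qed

lemma card_ge_of_disjoint_family:
  assumes "finite X" "disjoint_family_on R {..m::nat}" "\<And>j. j \<le> m \<Longrightarrow> X \<inter> R j \<noteq> {}"
  shows "Suc m \<le> card X"
proof -
  define f where "f j = (SOME x. x \<in> X \<inter> R j)" for j
  have f: "f j \<in> X \<inter> R j" if "j \<le> m" for j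
    unfolding f_def using assms(3)[OF that] by (rule some_in_eq[THEN iffD2])
  have "inj_on f {..m}"
  proof (rule inj_onI, rule ccontr)
    fix i j assume "i \<in> {..m}" "j \<in> {..m}" "f i = f j" "i \<noteq> j"
    moreover from this have "R i \<inter> R j = {}" using assms(2) by (simp add: disjoint_family_on_def)
    ultimately show False using f[of i] f[of j] by auto
  qed
  then have "card {..m} \<le> card X" using f assms(1) by (intro card_inj_on_le[of f]) auto
  then show ?thesis by simp
qed

text \<open>The unions of a row and a column form a bramble, so some bag meets them all; it then meets
  every row or every column.\<close>

lemma grid_le_decomposition_width:
  assumes pg: "pair_graph G" and td: "tree_decomposition T B G"
    and R: "\<And>j. j \<le> m \<Longrightarrow> conn (parcs G) (R j) \<and> R j \<subseteq> pverts G" and C: "\<And>j. j \<le> m \<Longrightarrow> conn (parcs G) (C j) \<and> C j \<subseteq> pverts G"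
    and disj: "disjoint_family_on R {..m}" "disjoint_family_on C {..m}"
    and meet: "\<And>i j. i \<le> m \<Longrightarrow> j \<le> m \<Longrightarrow> R i \<inter> C j \<noteq> {}"
  shows "m \<le> decomposition_width T B"
proof -
  have ut: "utree T" using td by (simp add: tree_decomposition_def)
  then obtain rt where rt: "rt \<in> pverts T"
    using connected_with_proj_iff[OF pair_graph_sym] by (auto simp: utree_def)
  interpret depth_tree T rt "lev (parcs T) {rt}" using depth_tree_of_utree[OF ut rt] .
  define \<S> where "\<S> = {bag_nodes T B (R i \<union> C j) | i j. i \<le> m \<and> j \<le> m}"
  have \<S>E: thesis if "S \<in> \<S>" "\<And>i j. S = bag_nodes T B (R i \<union> C j) \<Longrightarrow> i \<le> m \<Longrightarrow> j \<le> m \<Longrightarrow> thesis" for S thesis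
    using that unfolding \<S>_def by blast
  have cross: "conn (parcs G) (R i \<union> C j)" "R i \<union> C j \<subseteq> pverts G" "R i \<union> C j \<noteq> {}" if "i \<le> m" "j \<le> m" for i j
    using conn_Un[OF pair_graph_sym[OF pg]] R[OF that(1)] C[OF that(2)] meet[OF that] by auto
  have sub: "S \<subseteq> pverts T \<and> S \<noteq> {} \<and> conn (parcs T) S" if S: "S \<in> \<S>" for S
  proof -
    obtain i j where ij: "S = bag_nodes T B (R i \<union> C j)" "i \<le> m" "j \<le> m" using \<S>E[OF S] .
    show ?thesis using conn_bag_nodes[OF td cross[OF ij(2,3)]] unfolding ij(1) by (auto simp: bag_nodes_def)
  qed
  have int: "S \<inter> S' \<noteq> {}" if SS: "S \<in> \<S>" "S' \<in> \<S>" for S S'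
  proof -
    obtain i j i' j' where ij: "S = bag_nodes T B (R i \<union> C j)" "i \<le> m" "j \<le> m"
      "S' = bag_nodes T B (R i' \<union> C j')" "i' \<le> m" "j' \<le> m"
      using \<S>E[OF SS(1)] \<S>E[OF SS(2)] by metis
    \<comment> \<open>The row of one cross meets the column of the other, and any bag with the
      common vertex serves both.\<close>
    obtain v where v: "v \<in> R i" "v \<in> C j'" using meet[OF ij(2,6)] by blast
    have "bag_nodes T B {v} \<noteq> {}"
      using conn_bag_nodes(2)[OF td conn_singleton, of v] v R[OF ij(2)] by blast
    then show ?thesis using v unfolding ij(1,4) bag_nodes_def by blast
  qed
  have "\<S> \<noteq> {}" unfolding \<S>_def by blast
  then obtain t where t: "t \<in> pverts T" "\<And>S. S \<in> \<S> \<Longrightarrow> t \<in> S"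
    using helly[OF _ sub int] by metis
  have hit: "B t \<inter> (R i \<union> C j) \<noteq> {}" if "i \<le> m" "j \<le> m" for i j
  proof -
    have "bag_nodes T B (R i \<union> C j) \<in> \<S>" using that unfolding \<S>_def by blast
    then have "t \<in> bag_nodes T B (R i \<union> C j)" by (rule t(2))
    then show ?thesis by (simp add: bag_nodes_def)
  qed
  have "(\<forall>i\<le>m. B t \<inter> R i \<noteq> {}) \<or> (\<forall>j\<le>m. B t \<inter> C j \<noteq> {})"
  proof (rule ccontr)
    assume "\<not> ?thesis"
    then obtain i j where "i \<le> m" "B t \<inter> R i = {}" "j \<le> m" "B t \<inter> C j = {}" by auto
    then show False using hit[of i j] by (simp add: Int_Un_distrib)
  qed
  moreover have "finite (B t)"
    using td t(1) pair_graph_finite[OF pg] by (auto simp: tree_decomposition_def intro: finite_subset)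
  ultimately have "Suc m \<le> card (B t)"
    using card_ge_of_disjoint_family[OF _ disj(1)] card_ge_of_disjoint_family[OF _ disj(2)] by blast
  also have "\<dots> \<le> Max ((\<lambda>x. card (B x)) ` pverts T)" using t(1) finite_nodes by (intro Max_ge) auto
  finally show ?thesis unfolding decomposition_width_def by linarith
qed

text \<open>The \<open>LEAST\<close> in \<open>treewidth\<close> is meaningful because a single node
  whose bag is the whole vertex set is a decomposition.\<close>

lemma treewidth_attained:
  assumes "pair_graph G"
  obtains T :: "nat pair_pre_digraph" and B where "tree_decomposition T B G" "decomposition_width T B = treewidth G"
proof -
  define T :: "nat pair_pre_digraph" where "T = \<lparr> pverts = {0}, parcs = {} \<rparr>"
  interpret depth_tree T 0 "\<lambda>_. 0" by unfold_locales (auto simp: T_def sym_def)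
  have "tree_decomposition T (\<lambda>_. pverts G) G"
    unfolding tree_decomposition_def connected_induce_iff[OF sym_arcs]
    using utree pair_graph_parcs_subset[OF assms] by (auto simp: T_def conn_def)
  then have "\<exists>k. \<exists>(T :: nat pair_pre_digraph) B. tree_decomposition T B G \<and> decomposition_width T B = k" by blast
  then have "\<exists>(T :: nat pair_pre_digraph) B. tree_decomposition T B G \<and> decomposition_width T B = treewidth G"
    unfolding treewidth_def by (rule LeastI_ex)
  then show ?thesis using that by blast
qed

section \<open>The tree of distance layers\<close>

text \<open>\<open>\<mu>\<close> is an infimum over walks, so a single walk of \<open>n\<close> arcs
  of cost 1 gives the bound.\<close>

lemma graph_dist_le:
  assumes "pair_graph G" "v \<in> pverts G" "(v, w) \<in> parcs G ^^ n"
  shows "graph_dist G v w \<le> ereal (real n)"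
proof -
  interpret pair_graph G by (rule assms(1))
  have "\<exists>p. awalk v p w \<and> length p = n" using assms(2,3)
  proof (induction n arbitrary: v)
    case 0
    then show ?case by (intro exI[of _ "[]"]) (auto simp: awalk_def)
  next
    case (Suc n)
    then obtain u where u: "(v, u) \<in> parcs G" "(u, w) \<in> parcs G ^^ n" by (meson relpow_Suc_D2)
    then obtain p where "awalk u p w" "length p = n" using Suc.IH wellformed' by blast
    then show ?case using u Suc.prems by (intro exI[of _ "(v, u) # p"]) (auto simp: awalk_def)
  qed
  then obtain p where p: "awalk v p w" "length p = n" by blast
  have "awalk_cost (\<lambda>_. 1) p = real (length p)" by (induction p) auto
  then show ?thesis
    unfolding graph_dist_def \<mu>_def using p by (metis (mono_tags, lifting) INF_lower mem_Collect_eq)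
qed

locale rooted_graph = connected_graph +
  fixes r
  assumes r: "r \<in> V"
begin

abbreviation dist_r :: "'a \<Rightarrow> nat" where "dist_r \<equiv> lev E {r}"

lemma root_set: "{r} \<noteq> {}" "{r} \<subseteq> V" using r by auto

definition layer_part :: "'a \<Rightarrow> 'a set" where
  "layer_part v = {w \<in> component_in E {x \<in> V. dist_r v \<le> dist_r x} v. dist_r w = dist_r v}"

lemma layer_part_subset: "layer_part v \<subseteq> V"
  using component_in_subset[of E "{x \<in> V. dist_r v \<le> dist_r x}" v] unfolding layer_part_def by blast

lemma layer_part_refl: "v \<in> V \<Longrightarrow> v \<in> layer_part v"
  by (simp add: layer_part_def component_in_refl)

lemma layer_part_eqI: assumes "w \<in> layer_part v" shows "layer_part w = layer_part v"
proof -
  have w: "dist_r w = dist_r v" "w \<in> component_in E {x \<in> V. dist_r v \<le> dist_r x} v"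
    using assms by (auto simp: layer_part_def)
  show ?thesis unfolding layer_part_def w(1) component_in_eq[OF sym w(2)] ..
qed

lemma layer_part_eq_iff: "v \<in> V \<Longrightarrow> w \<in> V \<Longrightarrow> layer_part w = layer_part v \<longleftrightarrow> w \<in> layer_part v"
  using layer_part_eqI layer_part_refl by metis

lemma dist_part: "v \<in> V \<Longrightarrow> w \<in> V \<Longrightarrow> layer_part v = layer_part w \<Longrightarrow> dist_r v = dist_r w"
  using layer_part_eq_iff[of w v] by (simp add: layer_part_def)

lemma layer_part_edge: assumes "(u, v) \<in> E" "dist_r u = dist_r v" shows "layer_part u = layer_part v"
proof -
  have "u \<in> V" "v \<in> V" using assms edges by auto
  then have "v \<in> layer_part u"
    using component_in_step[OF component_in_refl, of u "{x \<in> V. dist_r u \<le> dist_r x}" v E] assms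
    by (simp add: layer_part_def)
  then show ?thesis using layer_part_eqI by simp
qed

text \<open>The component joining \<open>u\<close> to \<open>u'\<close> stays connected when the
  next lower level is added, and there it also contains \<open>v\<close> and \<open>v'\<close>. This
  is why the parts form a tree.\<close>

lemma layer_part_parent_unique:
  assumes "layer_part u = layer_part u'" "(u, v) \<in> E" "(u', v') \<in> E" "dist_r v < dist_r u" "dist_r v' < dist_r u'"
  shows "layer_part v = layer_part v'"
proof -
  have V: "u \<in> V" "u' \<in> V" "v \<in> V" "v' \<in> V" using assms edges by auto
  have vu: "(v, u) \<in> E" "(v', u') \<in> E" using assms sym by (auto dest: symD)
  have eq: "dist_r u = dist_r u'" using dist_part V assms by blast
  then have d: "dist_r u = Suc (dist_r v)" "dist_r u' = Suc (dist_r v)" "dist_r v' = dist_r v"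
    using lev_edge[OF root_set vu(1)] lev_edge[OF root_set vu(2)] assms by auto
  let ?S = "{x \<in> V. dist_r v \<le> dist_r x}"
  have u: "u \<in> component_in E ?S v"
    using component_in_step[OF component_in_refl vu(1), of ?S] V d by simp
  have "u' \<in> component_in E {x \<in> V. dist_r u \<le> dist_r x} u"
    using assms(1) layer_part_refl[OF V(2)] unfolding layer_part_def by auto
  moreover have "{x \<in> V. dist_r u \<le> dist_r x} \<subseteq> ?S" using d by auto
  ultimately have "u' \<in> component_in E ?S u" by (rule subsetD[OF component_in_mono, rotated])
  then have "u' \<in> component_in E ?S v" using component_in_eq[OF sym u] by simp
  then have "v' \<in> component_in E ?S v" using component_in_step[OF _ assms(3), of ?S v] V d by simp
  then show ?thesis using layer_part_eqI[of v' v] d(3) by (simp add: layer_part_def)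
qed

text \<open>Parts are coded by natural numbers, the node type in the theorem; an injective coding
  exists because \<open>V\<close> has finitely many subsets.\<close>

definition node :: "'a \<Rightarrow> nat" where
  "node v = (SOME g. inj_on g (Pow V)) (layer_part v)"

lemma node_eq_iff: "node v = node w \<longleftrightarrow> layer_part v = layer_part w"
proof -
  have "\<exists>g :: 'a set \<Rightarrow> nat. inj_on g (Pow V)"
    using finite_imp_inj_to_nat_seg[of "Pow V"] fin by auto
  then have "inj_on (SOME g :: 'a set \<Rightarrow> nat. inj_on g (Pow V)) (Pow V)" by (rule someI_ex)
  then show ?thesis unfolding node_def using layer_part_subset by (auto simp: inj_on_eq_iff)
qed

text \<open>The quotient of the graph by its parts. The condition on distances discards exactly the
  edges inside a part, since an edge within one level never leaves its part.\<close>

definition layer_tree :: "nat pair_pre_digraph" where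
  "layer_tree = \<lparr> pverts = node ` V, parcs = {(node u, node v) | u v. (u, v) \<in> E \<and> dist_r u \<noteq> dist_r v} \<rparr>"

text \<open>Any representative gives the same value, because a part lies in a single level.\<close>

definition node_depth :: "nat \<Rightarrow> nat" where
  "node_depth n = dist_r (SOME v. v \<in> V \<and> node v = n)"

definition node_part :: "nat \<Rightarrow> 'a set" where
  "node_part n = {v \<in> V. node v = n}"

lemma node_depth: assumes "v \<in> V" shows "node_depth (node v) = dist_r v"
proof -
  have "\<exists>w. w \<in> V \<and> node w = node v" using assms by blast
  then have "(SOME w. w \<in> V \<and> node w = node v) \<in> V \<and> node (SOME w. w \<in> V \<and> node w = node v) = node v"
    by (rule someI_ex)
  then show ?thesis unfolding node_depth_def using dist_part node_eq_iff assms by blast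
qed

lemma layer_arcE:
  assumes "(x, y) \<in> parcs layer_tree"
  obtains u v where "x = node u" "y = node v" "(u, v) \<in> E" "u \<in> V" "v \<in> V" "dist_r u \<noteq> dist_r v"
  using assms edges unfolding layer_tree_def by auto

lemma layer_arcI: "(u, v) \<in> E \<Longrightarrow> dist_r u \<noteq> dist_r v \<Longrightarrow> (node u, node v) \<in> parcs layer_tree"
  unfolding layer_tree_def by auto

lemma dist_r_eq_0_iff: "v \<in> V \<Longrightarrow> dist_r v = 0 \<longleftrightarrow> v = r"
  using lev_eq_0_iff[OF root_set] by simp

lemma dist_r_predecessor:
  assumes "v \<in> V" "v \<noteq> r"
  obtains u where "(v, u) \<in> E" "u \<in> V" "dist_r u < dist_r v"
proof -
  obtain n where n: "dist_r v = Suc n" using assms dist_r_eq_0_iff not0_implies_Suc by blast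
  obtain u where "(u, v) \<in> E" "u \<in> V" "dist_r u = n" using lev_predecessor[OF root_set assms(1) n] .
  then show ?thesis using that n sym by (auto dest: symD)
qed

lemma node_eq_root_iff: "v \<in> V \<Longrightarrow> node v = node r \<longleftrightarrow> v = r"
  using node_eq_iff dist_part[of v r] dist_r_eq_0_iff r by metis

sublocale layer_tree: depth_tree layer_tree "node r" node_depth
proof
  show "finite (pverts layer_tree)" "node r \<in> pverts layer_tree" using fin r by (auto simp: layer_tree_def)
  show "parcs layer_tree \<subseteq> pverts layer_tree \<times> pverts layer_tree"
    using edges by (auto simp: layer_tree_def)
  show "Relation.sym (parcs layer_tree)"
    using sym by (auto simp: layer_tree_def intro!: symI dest: symD) (metis symD)
next
  fix x assume "x \<in> pverts layer_tree"
  then obtain v where v: "v \<in> V" "x = node v" by (auto simp: layer_tree_def)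
  then show "node_depth x = 0 \<longleftrightarrow> x = node r"
    using node_depth node_eq_root_iff dist_r_eq_0_iff by simp
  assume "x \<noteq> node r"
  then obtain u where "(v, u) \<in> E" "u \<in> V" "dist_r u < dist_r v" using v dist_r_predecessor by blast
  then show "\<exists>y. (x, y) \<in> parcs layer_tree \<and> node_depth y < node_depth x"
    using v node_depth layer_arcI[of v u] by (intro exI[of _ "node u"]) simp
next
  fix x y assume "(x, y) \<in> parcs layer_tree"
  then obtain u v where uv: "x = node u" "y = node v" "(u, v) \<in> E" "u \<in> V" "v \<in> V" "dist_r u \<noteq> dist_r v"
    by (rule layer_arcE)
  have vu: "(v, u) \<in> E" using uv sym by (auto dest: symD)
  show "node_depth x = Suc (node_depth y) \<or> node_depth y = Suc (node_depth x)"
    using lev_edge[OF root_set uv(3)] lev_edge[OF root_set vu] uv node_depth by auto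
next
  fix x y z assume "(x, y) \<in> parcs layer_tree" "(x, z) \<in> parcs layer_tree"
    and less: "node_depth y < node_depth x" "node_depth z < node_depth x"
  obtain u v where uv: "x = node u" "y = node v" "(u, v) \<in> E" "u \<in> V" "v \<in> V"
    using \<open>(x, y) \<in> parcs layer_tree\<close> by (rule layer_arcE)
  obtain u' v' where uv': "x = node u'" "z = node v'" "(u', v') \<in> E" "u' \<in> V" "v' \<in> V"
    using \<open>(x, z) \<in> parcs layer_tree\<close> by (rule layer_arcE)
  have "dist_r v < dist_r u" using less(1) uv node_depth by simp
  moreover have "dist_r v' < dist_r u'" using less(2) node_depth[OF uv'(4)] node_depth[OF uv'(5)] uv' by simp
  moreover have "layer_part u = layer_part u'" using uv uv' node_eq_iff by metis
  ultimately show "y = z" using layer_part_parent_unique[OF _ uv(3) uv'(3)] node_eq_iff uv(2) uv'(2) by metis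
qed

lemma rooted_tree_partition_layer_tree:
  assumes "V = pverts G" "E = parcs G"
  shows "rooted_tree_partition layer_tree (node r) node_part G"
proof -
  have "utree layer_tree" by (rule layer_tree.utree)
  moreover have "disjoint_family_on node_part (pverts layer_tree)"
    by (auto simp: disjoint_family_on_def node_part_def)
  moreover have "(\<Union>x\<in>pverts layer_tree. node_part x) = V" by (auto simp: node_part_def layer_tree_def)
  moreover have "x = y \<or> (x, y) \<in> parcs layer_tree" if "(v, w) \<in> E" "v \<in> node_part x" "w \<in> node_part y" for v w x y
    using that layer_part_edge[of v w] layer_arcI[of v w] node_eq_iff[of v w] by (auto simp: node_part_def)
  ultimately show ?thesis
    unfolding rooted_tree_partition_def tree_partition_def using layer_tree.root_node assms by blast
qed

text \<open>Every vertex other than \<open>r\<close> has a neighbour closer to \<open>r\<close>; the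
  uniqueness of shallower neighbours in the tree puts it into the parent part.\<close>

lemma parent_dominated_layer_tree:
  assumes "E = parcs G"
  shows "parent_dominated layer_tree (node r) node_part G"
proof -
  have "\<exists>w\<in>node_part y. (v, w) \<in> E" if xy: "parent_of layer_tree (node r) y x" "v \<in> node_part x" for x y v
  proof -
    have arc: "(x, y) \<in> parcs layer_tree" "node_depth y < node_depth x"
      using layer_tree.parent_of_depth[OF xy(1)] .
    have v: "v \<in> V" "x = node v" using xy(2) by (auto simp: node_part_def)
    then have "v \<noteq> r" using arc(2) layer_tree.depth_eq_0_iff[OF layer_tree.root_node] by auto
    then obtain u where u: "(v, u) \<in> E" "u \<in> V" "dist_r u < dist_r v" using v dist_r_predecessor by blast
    then have "node u = y"
      using layer_tree.parent_unique[OF _ arc(1) _ arc(2)] layer_arcI[OF u(1)] node_depth u v by auto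
    then show ?thesis using u by (auto simp: node_part_def)
  qed
  then show ?thesis unfolding parent_dominated_def assms[symmetric] by blast
qed

lemma node_part_root: "node_part (node r) = {r}"
  using node_eq_root_iff r by (auto simp: node_part_def)

end

theorem lemma16:
  fixes G :: "'a pair_pre_digraph" and r :: 'a
  assumes "planar_triangulation G"
    and "r \<in> pverts G"
  shows "\<exists>(T :: nat pair_pre_digraph) r\<^sub>0 B.
    rooted_tree_partition T r\<^sub>0 B G \<and>
    parent_dominated T r\<^sub>0 B G \<and>
    weak_diameter T B G \<le> ereal (real (3 * treewidth G + 2)) \<and>
    B r\<^sub>0 = {r}"
proof -
  have pg: "pair_graph G" using assms(1) by (simp add: planar_triangulation_def)
  obtain p \<gamma> where "plane_embedding G p \<gamma>" "\<forall>F\<in>faces G p \<gamma>. bounded_by_triangle G \<gamma> F"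
    using assms(1) by (auto simp: planar_triangulation_def)
  then interpret triangulation G p \<gamma> using pg by (simp add: triangulation_def)
  interpret rooted_graph "pverts G" "parcs G" r
    by (intro rooted_graph.intro rooted_graph_axioms.intro connected_graph_axioms assms(2))
  let ?k = "treewidth G"
  have "graph_dist G v w \<le> ereal (real (3 * ?k + 2))" if "v \<in> node_part x" "w \<in> node_part x" for v w x
  proof -
    have v: "v \<in> pverts G" and w: "w \<in> layer_part v"
      using that layer_part_eq_iff[of v w] node_eq_iff[of w v] by (auto simp: node_part_def)
    have "\<exists>m\<le>3 * ?k + 2. (v, w) \<in> parcs G ^^ m"
    proof (rule ccontr)
      assume far: "\<not> (\<exists>m\<le>3 * ?k + 2. (v, w) \<in> parcs G ^^ m)"
      obtain T :: "nat pair_pre_digraph" and B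
        where td: "tree_decomposition T B G" "decomposition_width T B = ?k" using treewidth_attained[OF pg] .
      have w': "w \<in> component_in (parcs G) {x \<in> pverts G. dist_r v \<le> dist_r x} v" "dist_r w = dist_r v"
        using w by (auto simp: layer_part_def)
      have far': "(v, w) \<notin> parcs G ^^ m" if "m \<le> 3 * ?k + 2" for m using far that by blast
      \<comment> \<open>Indices from \<open>0\<close> to \<open>Suc ?k\<close> make
        \<open>?k + 2\<close> rows and columns, more than a decomposition of width \<open>?k\<close>
        allows.\<close>
      have "Suc ?k \<le> decomposition_width T B"
      proof (rule grid_of_far_vertices[OF assms(2) v w' far'])
        fix R C :: "nat \<Rightarrow> 'a set"
        assume grid: "\<And>j. j \<le> Suc ?k \<Longrightarrow> conn (parcs G) (R j) \<and> R j \<subseteq> pverts G"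
          "\<And>j. j \<le> Suc ?k \<Longrightarrow> conn (parcs G) (C j) \<and> C j \<subseteq> pverts G"
          "disjoint_family_on R {..Suc ?k}" "disjoint_family_on C {..Suc ?k}"
          "\<And>i j. i \<le> Suc ?k \<Longrightarrow> j \<le> Suc ?k \<Longrightarrow> R i \<inter> C j \<noteq> {}"
        show ?thesis
          by (rule grid_le_decomposition_width[where R = R and C = C, OF pg td(1)]) (fact grid)+
      qed
      then show False using td(2) by simp
    qed
    then obtain m where m: "m \<le> 3 * ?k + 2" "(v, w) \<in> parcs G ^^ m" by blast
    have "graph_dist G v w \<le> ereal (real m)" by (rule graph_dist_le[OF pg v m(2)])
    also have "\<dots> \<le> ereal (real (3 * ?k + 2))" using m(1) by (simp only: ereal_less_eq of_nat_le_iff)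
    finally show ?thesis .
  qed
  then have "weak_diameter layer_tree node_part G \<le> ereal (real (3 * ?k + 2))"
    unfolding weak_diameter_def by (intro Sup_least) blast
  then show ?thesis
    using rooted_tree_partition_layer_tree[OF refl refl] parent_dominated_layer_tree[OF refl] node_part_root by blast
qed

end
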